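(* If $G$ is a connected graph on an odd number $n\geq 3$ of vertices with $q(G)=2$ and $|E(G)|=2n-3$, then $G$ is isomorphic to the single-ended candle $G'_{(n-1)/2}$.
   Context: For a graph $G$ on $n$ vertices, $\mathcal{S}(G)$ is the set of real symmetric $n\times n$ matrices $A=[a_{ij}]$ with $a_{ij}\neq0$ for $i\ne j$ iff $\{i,j\}\in E(G)$ (diagonal unrestricted); $q(G)$ is the minimum number of distinct eigenvalues of a matrix in $\mathcal{S}(G)$. Single-ended candle: for $k\ge1$, $G'_k$ is the graph on $\{1,\dots,2k+1\}$ with levels $L_0=\{1\}$, $L_i=\{2i,2i+1\}$ ($1\le i\le k$), in which any two vertices in consecutive levels are adjacent, $2k$ and $2k+1$ are adjacent, and there are no other edges ($G'_1=K_3$). *)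

theory Defs
  imports "Jordan_Normal_Form.Char_Poly"
begin

definition simple_graph :: "'a set \<Rightarrow> 'a set set \<Rightarrow> bool" where
  "simple_graph V E \<longleftrightarrow> finite V \<and> (\<forall>e\<in>E. \<exists>u v. e = {u, v} \<and> u \<noteq> v \<and> u \<in> V \<and> v \<in> V)"

definition adj :: "'a set set \<Rightarrow> 'a \<Rightarrow> 'a \<Rightarrow> bool" where
  "adj E u v \<longleftrightarrow> {u, v} \<in> E"

definition connected_graph :: "'a set \<Rightarrow> 'a set set \<Rightarrow> bool" where
  "connected_graph V E \<longleftrightarrow> V \<noteq> {} \<and> (\<forall>u\<in>V. \<forall>v\<in>V. (adj E)\<^sup>*\<^sup>* u v)"

definition graph_iso :: "'a set \<Rightarrow> 'a set set \<Rightarrow> 'b set \<Rightarrow> 'b set set \<Rightarrow> bool" where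
  "graph_iso V E V' E' \<longleftrightarrow>
     (\<exists>f. bij_betw f V V' \<and> (\<forall>u\<in>V. \<forall>v\<in>V. {u, v} \<in> E \<longleftrightarrow> {f u, f v} \<in> E'))"

definition S_set :: "nat \<Rightarrow> nat set set \<Rightarrow> real mat set" where
  "S_set n E = {A. A \<in> carrier_mat n n \<and> A\<^sup>T = A \<and>
      (\<forall>i<n. \<forall>j<n. i \<noteq> j \<longrightarrow> (A $$ (i, j) \<noteq> 0 \<longleftrightarrow> {i, j} \<in> E))}"

definition num_distinct_eigenvalues :: "real mat \<Rightarrow> nat" where
  "num_distinct_eigenvalues A = card {c. eigenvalue A c}"

definition q :: "nat \<Rightarrow> nat set set \<Rightarrow> nat" where
  "q n E = (LEAST k. \<exists>A \<in> S_set n E. num_distinct_eigenvalues A = k)"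

definition candle_level :: "nat \<Rightarrow> nat set" where
  "candle_level i = (if i = 0 then {1} else {2 * i, 2 * i + 1})"

definition candle_vertices :: "nat \<Rightarrow> nat set" where
  "candle_vertices k = {1 .. 2 * k + 1}"

definition candle_edges :: "nat \<Rightarrow> nat set set" where
  "candle_edges k = {{u, v} | u v i. i < k \<and> u \<in> candle_level i \<and> v \<in> candle_level (i + 1)}
                    \<union> {{2 * k, 2 * k + 1}}"

end

(* A symmetric matrix A with exactly two eigenvalues a, b satisfies (A - a)(A - b) = 0, so
   subtracting (a + b)/2 from the diagonal gives M with the same off-diagonal entries and
   M^2 = s I.  Hence two nonadjacent vertices never have exactly one common neighbour, and every
   vertex at distance at least 2 from a root r has at least two neighbours one layer closer to r.
   With 2n - 3 edges, counting edges by layers leaves exactly deg r - 1 units of slack: edges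
   inside a layer, and downward neighbours beyond the second one.  Some edge always lies inside a
   layer: otherwise the graph is bipartite, adjacent vertices have opposite diagonal entries in M,
   and comparing the two colour classes forces n to be even.

   If deg r = 2, exactly one edge lies inside a layer and all downward degrees are 2.  Three
   vertices of one layer with pairwise common downward neighbours would force, pair by pair, three
   such vertices in the next layer, and so on forever; hence all layers beyond the root have two
   vertices, and since n is odd the last one does as well and carries the extra edge.

   If all degrees are at least 3, take r of degree 3, so that there is slack 2.  Either a single
   edge lies inside a layer; then its ends are adjacent twins, and counting again from one of them
   leaves no slack at all, so that the farthest vertices have degree 2.  Or two edges do, and
   every vertex of the last layer meets one of them, which leaves no room for three vertices in
   the layer below. *)

theory Submission
  imports Defs "Jordan_Normal_Form.Schur_Decomposition" "Jordan_Normal_Form.Jordan_Normal_Form_Uniqueness"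
begin

section \<open>Symmetric matrices with two eigenvalues\<close>

text \<open>The Hermitian form \<open>S\<close> of an eigenvector is its own conjugate by symmetry
  of \<open>A\<close>, and it equals \<open>e\<close> times the positive squared norm
  \<open>N\<close>.\<close>

lemma symmetric_eigenvalue_real:
  fixes A :: "real mat"
  assumes A: "A \<in> carrier_mat n n" and sym: "A\<^sup>T = A"
    and ev: "eigenvalue (map_mat complex_of_real A) e"
  shows "e \<in> \<real>"
proof -
  let ?C = "map_mat complex_of_real A"
  obtain v where v: "v \<in> carrier_vec n" "v \<noteq> 0\<^sub>v n" "?C *\<^sub>v v = e \<cdot>\<^sub>v v"
    using ev A unfolding eigenvalue_def eigenvector_def by auto
  have symA: "A $$ (i,j) = A $$ (j,i)" if "i < n" "j < n" for i j
    using sym A that by (metis carrier_matD index_transpose_mat(1))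
  have row: "(\<Sum>j<n. complex_of_real (A $$ (i,j)) * v $ j) = e * v $ i" if "i < n" for i
  proof -
    have "(?C *\<^sub>v v) $ i = (\<Sum>j<n. complex_of_real (A $$ (i,j)) * v $ j)"
      using A v(1) that by (simp add: scalar_prod_def atLeast0LessThan)
    then show ?thesis using v that by simp
  qed
  define S where "S = (\<Sum>i<n. \<Sum>j<n. cnj (v $ i) * (complex_of_real (A $$ (i,j)) * v $ j))"
  have "cnj S = (\<Sum>i<n. \<Sum>j<n. v $ i * (complex_of_real (A $$ (i,j)) * cnj (v $ j)))"
    by (simp add: S_def)
  also have "\<dots> = (\<Sum>j<n. \<Sum>i<n. v $ i * (complex_of_real (A $$ (i,j)) * cnj (v $ j)))"
    by (rule sum.swap)
  also have "\<dots> = S" unfolding S_def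
    by (intro sum.cong refl) (auto simp: symA)
  finally have "cnj S = S" .
  then have S: "S \<in> \<real>" by (simp add: Reals_cnj_iff)
  define N where "N = (\<Sum>i<n. (cmod (v $ i))\<^sup>2)"
  have "S = (\<Sum>i<n. cnj (v $ i) * (e * v $ i))"
    unfolding S_def by (intro sum.cong refl) (auto simp flip: row sum_distrib_left)
  also have "\<dots> = e * of_real N"
    unfolding N_def of_real_sum sum_distrib_left
    by (intro sum.cong refl) (simp add: complex_norm_square mult.commute mult.left_commute del: of_real_power)
  finally have SN: "S = e * of_real N" .
  obtain i where "i < n" "v $ i \<noteq> 0" using v(1,2) by (metis eq_vecI carrier_vecD index_zero_vec)
  then have "N > 0" unfolding N_def by (intro sum_pos2[of _ i]) auto
  then have "e = S / of_real N" using SN by simp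
  then show ?thesis using S by (metis Reals_divide Reals_of_real)
qed

text \<open>Over the complex numbers the polynomial splits, and all its roots are real; the
  splitting descends because the embedding of real polynomials is injective.\<close>

lemma symmetric_char_poly_factorized:
  fixes A :: "real mat"
  assumes A: "A \<in> carrier_mat n n" and sym: "A\<^sup>T = A"
  obtains es where "char_poly A = (\<Prod>e\<leftarrow>es. [:- e, 1:])"
proof -
  interpret of_real_poly: map_poly_inj_idom_hom complex_of_real ..
  let ?C = "map_mat complex_of_real A"
  have C: "?C \<in> carrier_mat n n" using A by simp
  obtain as where as: "char_poly ?C = (\<Prod>a\<leftarrow>as. [:- a, 1:])"
    using char_poly_factorized[OF C] by blast
  have re: "a = of_real (Re a)" if "a \<in> set as" for a
  proof -
    have "poly (char_poly ?C) a = 0" unfolding as using that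
      by (auto simp: poly_prod_list prod_list_zero_iff)
    then have "a \<in> \<real>" using eigenvalue_root_char_poly[OF C] symmetric_eigenvalue_real[OF A sym] by blast
    then show ?thesis by (auto elim: Reals_cases)
  qed
  have "map_poly complex_of_real (char_poly A) = char_poly ?C"
    by (rule of_real_hom.char_poly_hom[OF A, symmetric])
  also have "\<dots> = (\<Prod>a\<leftarrow>as. [:- of_real (Re a), 1:])"
    unfolding as using re by (metis (mono_tags, lifting) map_eq_conv)
  also have "\<dots> = map_poly complex_of_real (\<Prod>e\<leftarrow>map Re as. [:- e, 1:])"
    by (simp add: of_real_poly.hom_prod_list o_def)
  finally have "char_poly A = (\<Prod>e\<leftarrow>map Re as. [:- e, 1:])"
    by (simp only: of_real_poly.eq_iff)
  then show ?thesis by (rule that)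
qed

text \<open>A diagonal entry of \<open>N * N\<close> is the sum of squares of a row of
  \<open>N\<close>.\<close>

lemma symmetric_square_zero:
  fixes N :: "real mat"
  assumes N: "N \<in> carrier_mat n n" and sym: "N\<^sup>T = N" and sq: "N * N = 0\<^sub>m n n"
  shows "N = 0\<^sub>m n n"
proof (rule eq_matI)
  fix i j assume "i < dim_row (0\<^sub>m n n :: real mat)" "j < dim_col (0\<^sub>m n n :: real mat)"
  then have ij: "i < n" "j < n" by auto
  have symN: "N $$ (i,j) = N $$ (j,i)" if "i < n" "j < n" for i j
    using sym N that by (metis carrier_matD index_transpose_mat(1))
  have "0 = (N * N) $$ (i,i)" using sq ij by simp
  also have "\<dots> = (\<Sum>l<n. N $$ (i,l) * N $$ (l,i))"
    using N ij by (simp add: scalar_prod_def atLeast0LessThan)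
  also have "\<dots> = (\<Sum>l<n. (N $$ (i,l))\<^sup>2)"
    by (intro sum.cong refl) (use ij symN in \<open>auto simp: power2_eq_square\<close>)
  finally have "\<forall>l\<in>{..<n}. (N $$ (i,l))\<^sup>2 = 0"
    by (subst sum_nonneg_eq_0_iff[symmetric]) auto
  then show "N $$ (i,j) = 0\<^sub>m n n $$ (i,j)" using ij by simp
qed (use N in auto)

text \<open>Both similarities use the same \<open>P\<close> and \<open>Q\<close>, so the inner
  \<open>Q * P\<close> cancels.\<close>

lemma similar_mat_wit_mult:
  assumes AB: "similar_mat_wit A B P Q" and A'B': "similar_mat_wit A' B' P Q"
  shows "similar_mat_wit (A * A') (B * B') P Q"
proof -
  define n where "n = dim_row A"
  have 1: "P * Q = 1\<^sub>m n" "Q * P = 1\<^sub>m n" "A = P * B * Q" "A \<in> carrier_mat n n"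
    "B \<in> carrier_mat n n" "P \<in> carrier_mat n n" "Q \<in> carrier_mat n n"
    using similar_mat_witD[OF n_def AB] by auto
  have "dim_row A' = n"
    using carrier_matD(1)[OF 1(6)] carrier_matD(1)[OF similar_mat_witD(6)[OF refl A'B']] by simp
  then have 2: "A' = P * B' * Q" "A' \<in> carrier_mat n n" "B' \<in> carrier_mat n n"
    using similar_mat_witD(3,4,5)[OF _ A'B', of n] by simp_all
  note [simp] = 1(4-7) 2(2-3) mult_carrier_mat[of _ n n _ n]
  have "A * A' = P * B * Q * (P * (B' * Q))"
    unfolding 1(3)[symmetric] 2(1) using assoc_mult_mat[of P n n B' n Q n] by simp
  also have "\<dots> = P * B * (Q * (P * (B' * Q)))"
    by (rule assoc_mult_mat[of _ n n _ n _ n]) auto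
  also have "Q * (P * (B' * Q)) = Q * P * (B' * Q)"
    by (rule assoc_mult_mat[of _ n n _ n _ n, symmetric]) auto
  also have "\<dots> = B' * Q" unfolding 1(2) by (rule left_mult_one_mat[of _ n n]) auto
  also have "P * B * (B' * Q) = P * (B * B') * Q"
    by (simp add: assoc_mult_mat[of _ n n _ n _ n])
  finally have eq: "A * A' = P * (B * B') * Q" .
  show ?thesis by (rule similar_mat_witI[OF 1(1,2) eq]) auto
qed

text \<open>Squaring doubles the number of vanishing diagonals of \<open>T\<close>, and a symmetric matrix whose
  square is zero vanishes.\<close>

lemma symmetric_similar_strictly_upper_triangular:
  fixes N :: "real mat"
  assumes "N \<in> carrier_mat n n" and "N\<^sup>T = N" and "similar_mat_wit N T P Q"
    and "k \<ge> 1" and "\<And>i j. i < n \<Longrightarrow> j < n \<Longrightarrow> j < i + k \<Longrightarrow> T $$ (i,j) = 0"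
  shows "N = 0\<^sub>m n n"
  using assms
proof (induction "n - k" arbitrary: k N T rule: less_induct)
  case less
  note [simp] = less.prems(1)
  have wit: "T \<in> carrier_mat n n" "P \<in> carrier_mat n n" "Q \<in> carrier_mat n n" "N = P * T * Q"
    using similar_mat_witD2[OF less.prems(1,3)] by auto
  show ?case
  proof (cases "k < n")
    case False
    then have "T = 0\<^sub>m n n" using less.prems(5) wit(1) by (intro eq_matI) auto
    then show ?thesis using wit by simp
  next
    case True
    have "N * N = 0\<^sub>m n n"
    proof (rule less.hyps[of "2 * k"])
      show "n - 2 * k < n - k" using True less.prems(4) by simp
      show "N * N \<in> carrier_mat n n" using less.prems(1) less.prems(1) by (rule mult_carrier_mat)
      show "(N * N)\<^sup>T = N * N" using transpose_mult[OF less.prems(1) less.prems(1)] less.prems(2) by simp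
      show "similar_mat_wit (N * N) (T * T) P Q" by (rule similar_mat_wit_mult) fact+
      show "(T * T) $$ (i,j) = 0" if "i < n" "j < n" "j < i + 2 * k" for i j
      proof -
        have "(T * T) $$ (i,j) = (\<Sum>l<n. T $$ (i,l) * T $$ (l,j))"
          using wit(1) that by (simp add: scalar_prod_def atLeast0LessThan)
        also have "\<dots> = 0"
        proof (rule sum.neutral, rule ballI)
          \<comment> \<open>If \<open>l < i + k\<close> the left factor vanishes; otherwise
            \<open>j < l + k\<close> and the right one does.\<close>
          fix l assume "l \<in> {..<n}"
          then show "T $$ (i,l) * T $$ (l,j) = 0"
            using less.prems(5)[of i l] less.prems(5)[of l j] that by (cases "l < i + k") auto
        qed
        finally show ?thesis .
      qed
    qed (use less.prems in \<open>auto intro: mult_carrier_mat\<close>)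
    then show ?thesis using symmetric_square_zero less.prems by blast
  qed
qed

text \<open>This is (A - c)(A - d) = A^2 - (c + d) A + c d entry by entry. It serves the
  annihilating product and, with both shifts equal to the midpoint of the eigenvalues, the scalar
  square.\<close>

lemma shifted_mult_index:
  fixes A :: "real mat"
  assumes ij: "i < n" "j < n"
  shows "(\<Sum>k<n. (A $$ (i,k) - (if i = k then c else 0)) * (A $$ (k,j) - (if k = j then d else 0)))
    = (\<Sum>k<n. A $$ (i,k) * A $$ (k,j)) - (c + d) * A $$ (i,j) + (if i = j then c * d else 0)"
proof -
  have "(\<Sum>k<n. (A $$ (i,k) - (if i = k then c else 0)) * (A $$ (k,j) - (if k = j then d else 0)))
    = (\<Sum>k<n. A $$ (i,k) * A $$ (k,j) - (if i = k then c * A $$ (k,j) else 0)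
         - (if k = j then d * A $$ (i,k) else 0) + (if i = k then (if i = j then c * d else 0) else 0))"
    by (intro sum.cong refl) (auto simp: algebra_simps)
  also have "\<dots> = (\<Sum>k<n. A $$ (i,k) * A $$ (k,j)) - (c + d) * A $$ (i,j) + (if i = j then c * d else 0)"
    using ij by (simp add: sum.distrib sum_subtractf sum.delta sum.delta' algebra_simps)
  finally show ?thesis .
qed

lemma char_matrix_mult_index:
  fixes A :: "real mat"
  assumes A: "A \<in> carrier_mat n n" and ij: "i < n" "j < n"
  shows "(char_matrix A c * char_matrix A d) $$ (i,j)
    = (\<Sum>k<n. A $$ (i,k) * A $$ (k,j)) - (c + d) * A $$ (i,j) + (if i = j then c * d else 0)"
proof -
  have "(char_matrix A c * char_matrix A d) $$ (i,j)
      = (\<Sum>k<n. char_matrix A c $$ (i,k) * char_matrix A d $$ (k,j))"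
    using carrier_matD[OF char_matrix_closed[OF A]] ij by (simp add: scalar_prod_def atLeast0LessThan)
  also have "\<dots> = (\<Sum>k<n. (A $$ (i,k) - (if i = k then c else 0)) * (A $$ (k,j) - (if k = j then d else 0)))"
    using A ij by (intro sum.cong refl) (simp add: char_matrix_def)
  finally show ?thesis unfolding shifted_mult_index[OF ij] .
qed

text \<open>In a triangular form \<open>B\<close> every diagonal entry is \<open>a\<close> or
  \<open>b\<close>, so the product of the shifted matrices is strictly upper triangular. The product
  for \<open>A\<close> is symmetric because its factors commute, hence it vanishes.\<close>

lemma symmetric_two_eigenvalues_annihilated:
  fixes A :: "real mat"
  assumes A: "A \<in> carrier_mat n n" and sym: "A\<^sup>T = A" and ev: "{c. eigenvalue A c} = {a, b}"
  shows "char_matrix A a * char_matrix A b = 0\<^sub>m n n"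
proof -
  obtain es where es: "char_poly A = (\<Prod>e\<leftarrow>es. [:- e, 1:])"
    using symmetric_char_poly_factorized[OF A sym] .
  obtain B P Q where "schur_decomposition A es = (B, P, Q)" by (cases "schur_decomposition A es")
  from schur_decomposition[OF A es this]
  have sim: "similar_mat_wit A B P Q" and up: "upper_triangular B" and dg: "diag_mat B = es" by auto
  have B: "B \<in> carrier_mat n n" using similar_mat_witD2[OF A sim] by auto
  have diag: "B $$ (i,i) = a \<or> B $$ (i,i) = b" if "i < n" for i
  proof -
    have "B $$ (i,i) \<in> set es" using that B unfolding dg[symmetric] diag_mat_def by auto
    then have "poly (char_poly A) (B $$ (i,i)) = 0"
      unfolding es by (auto simp: poly_prod_list prod_list_zero_iff)
    then show ?thesis using eigenvalue_root_char_poly[OF A] ev by auto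
  qed
  have symA: "A $$ (i,j) = A $$ (j,i)" if "i < n" "j < n" for i j
    using sym A that by (metis carrier_matD index_transpose_mat(1))
  have low: "B $$ (i,j) = 0" if "j < i" "i < n" for i j using up B that by auto
  have cA: "char_matrix A c \<in> carrier_mat n n" for c using A by simp
  have cB: "char_matrix B c \<in> carrier_mat n n" for c using B by simp
  have cBi: "char_matrix B c $$ (i,j) = B $$ (i,j) - (if i = j then c else 0)" if "i < n" "j < n" for c i j
    using B that by (simp add: char_matrix_def)
  have cAs: "(char_matrix A c)\<^sup>T = char_matrix A c" for c
    using A symA by (intro eq_matI) (auto simp: char_matrix_def)
  have comm: "char_matrix A b * char_matrix A a = char_matrix A a * char_matrix A b"
    by (intro eq_matI)
      (use carrier_matD[OF cA] in \<open>auto simp: char_matrix_mult_index[OF A] algebra_simps simp del: index_mult_mat(1)\<close>)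
  show ?thesis
  proof (rule symmetric_similar_strictly_upper_triangular[of _ _ _ P Q 1])
    show "(char_matrix A a * char_matrix A b)\<^sup>T = char_matrix A a * char_matrix A b"
      using transpose_mult[OF cA cA] cAs comm by simp
    show "similar_mat_wit (char_matrix A a * char_matrix A b) (char_matrix B a * char_matrix B b) P Q"
      by (intro similar_mat_wit_mult similar_mat_wit_char_matrix sim)
    show "(char_matrix B a * char_matrix B b) $$ (i,j) = 0" if "i < n" "j < n" "j < i + 1" for i j
    proof -
      have "(char_matrix B a * char_matrix B b) $$ (i,j)
          = (\<Sum>l<n. char_matrix B a $$ (i,l) * char_matrix B b $$ (l,j))"
        using cB[of a] cB[of b] that by (simp add: scalar_prod_def atLeast0LessThan)
      also have "\<dots> = 0"
      proof (rule sum.neutral, rule ballI)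
        fix l assume l: "l \<in> {..<n}"
        \<comment> \<open>The first two cases put a factor below the diagonal. Otherwise
          \<open>j \<le> i\<close> forces all three indices to agree, and \<open>diag\<close> kills
          one factor.\<close>
        consider "l < i" | "j < l" | "l = i" "j = i" using \<open>j < i + 1\<close> by linarith
        then show "char_matrix B a $$ (i,l) * char_matrix B b $$ (l,j) = 0"
          using that l low[of l i] low[of j l] diag[of l] by cases (auto simp: cBi)
      qed
      finally show ?thesis .
    qed
  qed (use mult_carrier_mat[OF cA cA] in auto)
qed

text \<open>Centring the eigenvalues at 0 removes the linear term; \<open>s\<close> is the square of
  half their gap. Functions replace matrices because the graph part works over an arbitrary vertex
  type.\<close>

lemma symmetric_two_eigenvalues_shift:
  fixes A :: "real mat"
  assumes A: "A \<in> carrier_mat n n" and sym: "A\<^sup>T = A"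
    and two: "num_distinct_eigenvalues A = 2"
  shows "\<exists>(M :: nat \<Rightarrow> nat \<Rightarrow> real) s. \<forall>i<n. \<forall>j<n. M i j = M j i
    \<and> (i \<noteq> j \<longrightarrow> M i j = A $$ (i,j)) \<and> (\<Sum>k<n. M i k * M k j) = (if i = j then s else 0)"
proof -
  obtain a b where ab: "{c. eigenvalue A c} = {a, b}"
    using two unfolding num_distinct_eigenvalues_def card_2_iff by blast
  have symA: "A $$ (i,j) = A $$ (j,i)" if "i < n" "j < n" for i j
    using sym A that by (metis carrier_matD index_transpose_mat(1))
  define m where "m = (a + b) / 2"
  define M where "M i j = A $$ (i,j) - (if i = j then m else 0)" for i j
  have "(\<Sum>k<n. M i k * M k j) = (if i = j then ((a - b) / 2)\<^sup>2 else 0)" if ij: "i < n" "j < n" for i j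
  proof -
    have "(\<Sum>k<n. A $$ (i,k) * A $$ (k,j)) = (a + b) * A $$ (i,j) - (if i = j then a * b else 0)"
      using char_matrix_mult_index[OF A ij, of a b] ij
        symmetric_two_eigenvalues_annihilated[OF A sym ab] by simp
    then show ?thesis unfolding M_def shifted_mult_index[OF ij] m_def by (auto simp: power2_eq_square field_simps)
  qed
  then have "\<forall>i<n. \<forall>j<n. M i j = M j i \<and> (i \<noteq> j \<longrightarrow> M i j = A $$ (i,j))
      \<and> (\<Sum>k<n. M i k * M k j) = (if i = j then ((a - b) / 2)\<^sup>2 else 0)"
    by (auto simp: M_def symA)
  then show ?thesis by blast
qed

section \<open>Distance layers of a sparse graph with two eigenvalues\<close>

text \<open>The graph argument sees the matrix only through its symmetry, its off-diagonal zero
  pattern and \<open>M_square\<close>.\<close>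

locale sparse_two_eigenvalue_graph =
  fixes V :: "'a set" and adjacent :: "'a \<Rightarrow> 'a \<Rightarrow> bool" (infix "\<sim>" 50)
    and M :: "'a \<Rightarrow> 'a \<Rightarrow> real" and s :: real
  assumes finite_V: "finite V"
    and adjacent_in_V: "u \<sim> v \<Longrightarrow> u \<in> V \<and> v \<in> V"
    and adjacent_sym: "u \<sim> v \<Longrightarrow> v \<sim> u"
    and adjacent_irrefl: "\<not> u \<sim> u"
    and connected: "u \<in> V \<Longrightarrow> v \<in> V \<Longrightarrow> (\<sim>)\<^sup>*\<^sup>* u v"
    and M_sym: "u \<in> V \<Longrightarrow> v \<in> V \<Longrightarrow> M u v = M v u"
    and M_nonzero_iff: "u \<in> V \<Longrightarrow> v \<in> V \<Longrightarrow> u \<noteq> v \<Longrightarrow> M u v \<noteq> 0 \<longleftrightarrow> u \<sim> v"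
    and M_square: "u \<in> V \<Longrightarrow> v \<in> V \<Longrightarrow> (\<Sum>w\<in>V. M u w * M w v) = (if u = v then s else 0)"
    and card_arcs: "card {(u, v). u \<sim> v} + 6 = 4 * card V"
      \<comment> \<open>arcs are ordered pairs: this says that there are \<open>2 n - 3\<close> edges\<close>
    and odd_card: "odd (card V)"
begin

lemma adjacent_commute: "u \<sim> v \<longleftrightarrow> v \<sim> u"
  using adjacent_sym by blast

text \<open>In the (u, v) entry of M^2 the terms at \<open>u\<close> and \<open>v\<close> carry the
  factor \<open>M u v\<close>, which is 0; thus diagonal entries drop out.\<close>

lemma sum_common_neighbours:
  assumes uv: "u \<in> V" "v \<in> V" "u \<noteq> v" "\<not> u \<sim> v"
  shows "(\<Sum>w | w \<sim> u \<and> w \<sim> v. M u w * M w v) = 0"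
proof -
  have "(\<Sum>w\<in>V. M u w * M w v) = (\<Sum>w | w \<sim> u \<and> w \<sim> v. M u w * M w v)"
  proof (rule sum.mono_neutral_right)
    show "\<forall>w\<in>V - {w. w \<sim> u \<and> w \<sim> v}. M u w * M w v = 0"
    proof
      fix w assume w: "w \<in> V - {w. w \<sim> u \<and> w \<sim> v}"
      have "\<not> u \<sim> v" "\<not> v \<sim> u" using uv adjacent_sym by blast+
      then have 1: "M u v = 0" "M v u = 0" using uv M_nonzero_iff by blast+
      have "w = u \<or> w = v \<or> M u w = 0 \<or> M w v = 0"
        using w uv(1-2) M_nonzero_iff adjacent_sym by blast
      then show "M u w * M w v = 0" using 1 by auto
    qed
  qed (use finite_V adjacent_in_V in auto)
  then show ?thesis using M_square uv by simp
qed

lemma adjacent_M_nonzero: "u \<sim> v \<Longrightarrow> M u v \<noteq> 0"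
  using M_nonzero_iff adjacent_in_V adjacent_irrefl by blast

text \<open>A single nonzero product cannot sum to 0. Most combinatorial arguments below start by
  producing this second common neighbour and then locate its layer.\<close>

lemma another_common_neighbour:
  assumes "u \<in> V" "v \<in> V" "u \<noteq> v" "\<not> u \<sim> v" "w \<sim> u" "w \<sim> v"
  shows "\<exists>x. x \<noteq> w \<and> x \<sim> u \<and> x \<sim> v"
proof (rule ccontr)
  assume "\<nexists>x. x \<noteq> w \<and> x \<sim> u \<and> x \<sim> v"
  then have "{x. x \<sim> u \<and> x \<sim> v} = {w}" using assms by blast
  then have "M u w * M w v = 0" using sum_common_neighbours[OF assms(1-4)] by simp
  then show False using adjacent_M_nonzero assms adjacent_commute by simp
qed

section \<open>Distance layers and the edge count by layers\<close>

definition level :: "'a \<Rightarrow> 'a \<Rightarrow> nat" where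
  "level r u = (LEAST k. ((\<sim>) ^^ k) r u)"

definition layer :: "'a \<Rightarrow> nat \<Rightarrow> 'a set" where
  "layer r i = {u \<in> V. level r u = i}"

definition down :: "'a \<Rightarrow> 'a \<Rightarrow> 'a set" where
  "down r u = {p. p \<sim> u \<and> Suc (level r p) = level r u}"

text \<open>Ordered pairs, as in \<open>card_arcs\<close>: each edge inside a layer contributes two
  elements.\<close>

definition intra :: "'a \<Rightarrow> ('a \<times> 'a) set" where
  "intra r = {(u, v). u \<sim> v \<and> level r u = level r v}"

definition neighbours :: "'a \<Rightarrow> 'a set" where
  "neighbours u = {v. v \<sim> u}"

lemma finite_neighbours [simp]: "finite (neighbours u)"
proof -
  have "neighbours u \<subseteq> V" using adjacent_in_V by (auto simp: neighbours_def)
  then show ?thesis using finite_V by (rule finite_subset)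
qed

lemma finite_down [simp]: "finite (down r u)"
  by (rule finite_subset[OF _ finite_neighbours[of u]]) (auto simp: neighbours_def down_def)

lemma finite_layer [simp]: "finite (layer r i)"
  using finite_V by (simp add: layer_def)

lemma finite_arcs: "finite {(u, v). u \<sim> v}"
  by (rule finite_subset[of _ "V \<times> V"]) (use finite_V adjacent_in_V in auto)

lemma finite_intra [simp]: "finite (intra r)"
  by (rule finite_subset[OF _ finite_arcs]) (auto simp: intra_def)

lemma intra_sym: "(u, v) \<in> intra r \<Longrightarrow> (v, u) \<in> intra r"
  by (auto simp: intra_def adjacent_commute)

context
  fixes r assumes r: "r \<in> V"
begin

lemma relpow_level: "u \<in> V \<Longrightarrow> ((\<sim>) ^^ level r u) r u"
  unfolding level_def using connected[OF r] by (metis LeastI_ex rtranclp_imp_relpowp)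

lemma level_le: "((\<sim>) ^^ k) r u \<Longrightarrow> level r u \<le> k"
  unfolding level_def by (rule Least_le)

lemma level_root [simp]: "level r r = 0"
  using level_le[of 0 r] by simp

lemma level_eq_0: "u \<in> V \<Longrightarrow> level r u = 0 \<longleftrightarrow> u = r"
  using relpow_level[of u] by auto

lemma level_step: "u \<sim> v \<Longrightarrow> level r v \<le> Suc (level r u)"
  using relpow_level[of u] adjacent_in_V by (intro level_le) auto

lemma adjacent_levels:
  assumes "u \<sim> v"
  shows "level r u = level r v \<or> level r u = Suc (level r v) \<or> level r v = Suc (level r u)"
  using level_step[OF assms] level_step[OF adjacent_sym[OF assms]] by linarith

lemma adjacent_levels_cases:
  assumes "u \<sim> v"
  obtains "level r u = level r v" | "level r u = Suc (level r v)" | "level r v = Suc (level r u)"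
  using adjacent_levels[OF assms] by blast

lemma down_nonempty:
  assumes "u \<in> V" "level r u = Suc k"
  obtains p where "p \<in> down r u"
proof -
  have "((\<sim>) ^^ Suc k) r u" using relpow_level[OF assms(1)] assms(2) by simp
  then obtain p where p: "((\<sim>) ^^ k) r p" "p \<sim> u" by auto
  have "level r p = k" using level_le[OF p(1)] level_step[OF p(2)] assms(2) by simp
  then show ?thesis using p(2) assms(2) by (intro that) (simp add: down_def)
qed

lemma down_level_1:
  assumes u: "u \<in> V" "level r u = 1"
  shows "down r u = {r}"
proof -
  have "p = r" if "p \<in> down r u" for p
    using that u level_eq_0[of p] adjacent_in_V[of p u] by (simp add: down_def)
  moreover obtain p where "p \<in> down r u" using down_nonempty[of u 0] u by auto
  ultimately show ?thesis by blast
qed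

lemma layer_0: "layer r 0 = {r}"
  using r level_eq_0 by (auto simp: layer_def)

lemma layer_1: "layer r 1 = neighbours r"
proof -
  have "u \<sim> r" if "u \<in> V" "level r u = 1" for u
    using down_level_1[OF that] adjacent_sym unfolding down_def by blast
  moreover have "level r u = 1" if "u \<sim> r" for u
    using level_step[OF adjacent_sym[OF that]] level_eq_0[of u] that adjacent_in_V adjacent_irrefl
    by (metis One_nat_def le_SucE le_zero_eq level_root)
  ultimately show ?thesis unfolding layer_def neighbours_def using adjacent_in_V by auto
qed

lemma down_in_layer: "p \<in> down r u \<Longrightarrow> level r u = Suc i \<Longrightarrow> p \<in> layer r i"
  using adjacent_in_V by (auto simp: down_def layer_def)

text \<open>Let \<open>w\<close> lie two layers below \<open>u\<close>, reached through
  \<open>p\<close>. These two are nonadjacent, and their second common neighbour is squeezed into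
  the layer of \<open>p\<close>.\<close>

lemma card_down_ge_2:
  assumes u: "u \<in> V" "level r u \<ge> 2"
  shows "card (down r u) \<ge> 2"
proof -
  obtain k where k: "level r u = Suc (Suc k)"
    using u(2) by (metis add_2_eq_Suc le_Suc_ex)
  obtain p where p: "p \<in> down r u" using down_nonempty u k by blast
  then have lp: "level r p = Suc k" "p \<in> V" "p \<sim> u" using k adjacent_in_V by (auto simp: down_def)
  obtain w where w: "w \<in> down r p" using down_nonempty lp by blast
  then have lw: "level r w = k" "w \<in> V" "w \<sim> p" using lp adjacent_in_V by (auto simp: down_def)
  have "\<not> w \<sim> u" "w \<noteq> u" using level_step[of w u] lw k by auto
  then obtain x where x: "x \<noteq> p" "x \<sim> w" "x \<sim> u"
    using another_common_neighbour[of w u p] lw lp u adjacent_sym by blast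
  have "level r x = Suc k" using level_step[OF x(3)] level_step[OF adjacent_sym[OF x(2)]] k lw by simp
  then have "{p, x} \<subseteq> down r u" using p x k by (auto simp: down_def)
  then show ?thesis using card_mono[of "down r u" "{p, x}"] x(1) by simp
qed

text \<open>By \<open>card_down_ge_2\<close> the natural subtraction is exact, so the sum really
  measures the downward neighbours beyond the second.\<close>

definition excess :: nat where
  "excess = (\<Sum>u\<in>{u \<in> V. level r u \<ge> 2}. card (down r u) - 2)"

text \<open>An arc goes down, up or stays in its layer, and swapping its ends matches the first two
  kinds.\<close>

lemma card_arcs_by_level: "card {(u, v). u \<sim> v} = 2 * (\<Sum>u\<in>V. card (down r u)) + card (intra r)"
proof -
  let ?D = "Sigma V (down r)"
  have fD: "finite ?D" using finite_V by simp
  have eq: "{(u, v). u \<sim> v} = (?D \<union> prod.swap ` ?D) \<union> intra r"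
  proof
    show "{(u, v). u \<sim> v} \<subseteq> (?D \<union> prod.swap ` ?D) \<union> intra r"
    proof
      fix a assume "a \<in> {(u, v). u \<sim> v}"
      then obtain u v where a: "a = (u, v)" and uv: "u \<sim> v" by auto
      have V: "u \<in> V" "v \<in> V" "v \<sim> u" using uv adjacent_in_V adjacent_sym by blast+
      from uv show "a \<in> (?D \<union> prod.swap ` ?D) \<union> intra r"
      proof (cases rule: adjacent_levels_cases)
        case 1
        then show ?thesis using a uv by (simp add: intra_def)
      next
        case 2
        then show ?thesis using a V by (simp add: down_def)
      next
        case 3
        then have "(v, u) \<in> ?D" using V uv by (simp add: down_def)
        then have "a \<in> prod.swap ` ?D" unfolding a by (metis image_eqI swap_simp)
        then show ?thesis by simp
      qed
    qed
  qed (auto simp: down_def intra_def adjacent_commute)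
  have "card ((?D \<union> prod.swap ` ?D) \<union> intra r) = card (?D \<union> prod.swap ` ?D) + card (intra r)"
    by (rule card_Un_disjoint) (use fD in simp_all, auto simp: down_def intra_def)
  also have "card (?D \<union> prod.swap ` ?D) = card ?D + card (prod.swap ` ?D)"
    by (rule card_Un_disjoint) (use fD in simp_all, auto simp: down_def)
  also have "card (prod.swap ` ?D) = card ?D" by (rule card_image) simp
  also have "card ?D = (\<Sum>u\<in>V. card (down r u))" using finite_V by simp
  finally show ?thesis unfolding eq by simp
qed

text \<open>The root has no downward neighbour, each vertex of layer 1 has one, every deeper vertex
  two plus its excess. Against the prescribed edge count the deeper layers cancel, and only the
  degree of \<open>r\<close> bounds the slack.\<close>

lemma degree_formula: "2 * excess + card (intra r) + 2 = 2 * card (neighbours r)"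
proof -
  let ?W = "{u \<in> V. level r u \<ge> 2}"
  have V: "V = (layer r 0 \<union> layer r 1) \<union> ?W" by (auto simp: layer_def)
  have dr: "down r r = {}" by (simp add: down_def)
  have S: "sum f V = f r + sum f (neighbours r) + sum f ?W" for f :: "'a \<Rightarrow> nat"
  proof -
    have "sum f V = sum f (layer r 0 \<union> layer r 1) + sum f ?W"
      by (subst V, rule sum.union_disjoint) (use finite_V in \<open>auto simp: layer_def\<close>)
    also have "sum f (layer r 0 \<union> layer r 1) = sum f (layer r 0) + sum f (layer r 1)"
      by (rule sum.union_disjoint) (use finite_V in \<open>auto simp: layer_def\<close>)
    finally show ?thesis by (simp add: layer_0 layer_1 del: One_nat_def)
  qed
  have "sum (\<lambda>u. card (down r u)) (neighbours r) = sum (\<lambda>u. 1) (neighbours r)"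
    by (rule sum.cong[OF refl]) (simp add: layer_1[symmetric] layer_def down_level_1)
  moreover have "sum (\<lambda>u. card (down r u)) ?W = excess + 2 * card ?W"
  proof -
    have "sum (\<lambda>u. card (down r u)) ?W = sum (\<lambda>u. (card (down r u) - 2) + 2) ?W"
    proof (rule sum.cong[OF refl])
      fix u assume "u \<in> ?W"
      then show "card (down r u) = card (down r u) - 2 + 2" using card_down_ge_2[of u] by simp
    qed
    then show ?thesis unfolding excess_def sum.distrib by simp
  qed
  ultimately have "(\<Sum>u\<in>V. card (down r u)) = card (neighbours r) + excess + 2 * card ?W"
    unfolding S by (simp add: dr)
  moreover have "card V = 1 + card (neighbours r) + card ?W"
    using S[of "\<lambda>_. 1"] by simp
  ultimately show ?thesis using card_arcs card_arcs_by_level by simp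
qed

lemma excess_0_iff: "excess = 0 \<longleftrightarrow> (\<forall>u\<in>V. level r u \<ge> 2 \<longrightarrow> card (down r u) = 2)"
proof -
  have "excess = 0 \<longleftrightarrow> (\<forall>u\<in>{u \<in> V. level r u \<ge> 2}. card (down r u) - 2 = 0)"
    unfolding excess_def by (rule sum_eq_0_iff) (simp add: finite_V)
  then show ?thesis using card_down_ge_2 by (auto simp: order_antisym)
qed

end

section \<open>Existence of an edge inside a layer\<close>

lemma neighbours_nonempty:
  assumes u: "u \<in> V" shows "neighbours u \<noteq> {}"
proof
  assume "neighbours u = {}"
  then have "card (neighbours u) = 0" by simp
  then show False using degree_formula[OF u] by linarith
qed

text \<open>Otherwise \<open>\<sigma>\<close> is a proper 2-colouring. The off-diagonal square sum
  of a row turns out to be the same for all vertices, and its \<open>\<sigma>\<close>-weighted total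
  is 0; since an odd number of signs cannot cancel, that square sum is 0, against
  connectedness.\<close>

lemma intra_nonempty:
  assumes r: "r \<in> V" shows "intra r \<noteq> {}"
proof
  assume no: "intra r = {}"
  define \<sigma> :: "'a \<Rightarrow> real" where "\<sigma> u = (-1) ^ level r u" for u
  have ad: "\<sigma> u = - \<sigma> v" if "u \<sim> v" for u v
  proof -
    have neq: "level r u \<noteq> level r v"
    proof
      assume "level r u = level r v"
      then have "(u, v) \<in> intra r" using that by (simp add: intra_def)
      then show False using no by simp
    qed
    from r that show ?thesis
      by (cases rule: adjacent_levels_cases) (use neq in \<open>simp_all add: \<sigma>_def\<close>)
  qed
  have s0: "\<sigma> u \<noteq> 0" for u by (simp add: \<sigma>_def)
  \<comment> \<open>The colouring excludes triangles, so only the two diagonal terms survive in the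
    (u, v) entry of M^2.\<close>
  have diag: "M v v = - M u u" if uv: "u \<sim> v" for u v
  proof -
    have in_V: "u \<in> V" "v \<in> V" "u \<noteq> v" using uv adjacent_in_V adjacent_irrefl by blast+
    have "0 = (\<Sum>x\<in>V. M u x * M x v)" using M_square in_V by simp
    also have "\<dots> = (\<Sum>x\<in>{u, v}. M u x * M x v)"
    proof (rule sum.mono_neutral_right)
      show "\<forall>x\<in>V - {u, v}. M u x * M x v = 0"
      proof
        fix x assume x: "x \<in> V - {u, v}"
        have "\<not> (u \<sim> x \<and> x \<sim> v)" using ad[of u x] ad[of x v] ad[of u v] uv s0[of u] by auto
        then show "M u x * M x v = 0" using x M_nonzero_iff[of u x] M_nonzero_iff[of x v] in_V by auto
      qed
    qed (use finite_V in_V in auto)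
    also have "\<dots> = M u v * (M u u + M v v)" using in_V by (simp add: algebra_simps)
    finally show ?thesis using M_nonzero_iff[of u v] in_V uv by simp
  qed
  have sq: "(M u u)\<^sup>2 = (M r r)\<^sup>2" if "u \<in> V" for u
  proof -
    have "(\<sim>)\<^sup>*\<^sup>* r u" using connected r that by blast
    then show ?thesis by (induction) (use diag in auto)
  qed
  have row: "s = (M u u)\<^sup>2 + (\<Sum>w\<in>V - {u}. (M u w)\<^sup>2)" if u: "u \<in> V" for u
  proof -
    have "s = (\<Sum>w\<in>V. (M u w)\<^sup>2)"
      using M_square[OF u u] M_sym[OF u] by (simp add: power2_eq_square)
    then show ?thesis using sum.remove[OF finite_V u] by simp
  qed
  \<comment> \<open>Each edge is weighted with opposite signs at its two ends, so the double sum of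
    \<open>f\<close> vanishes.\<close>
  define f where "f u w = (if w = u then 0 else \<sigma> u * (M u w)\<^sup>2)" for u w
  have f_anti: "f u w = - f w u" if "u \<in> V" "w \<in> V" for u w
    using that ad[of u w] M_nonzero_iff[of u w] M_sym[of u w] by (cases "u \<sim> w") (auto simp: f_def)
  have "(\<Sum>u\<in>V. \<Sum>w\<in>V. f u w) = (\<Sum>u\<in>V. \<Sum>w\<in>V. - f w u)"
    using f_anti by (intro sum.cong refl)
  also have "\<dots> = - (\<Sum>u\<in>V. \<Sum>w\<in>V. f w u)" by (simp only: sum_negf)
  also have "(\<Sum>u\<in>V. \<Sum>w\<in>V. f w u) = (\<Sum>u\<in>V. \<Sum>w\<in>V. f u w)" by (rule sum.swap)
  finally have f0: "(\<Sum>u\<in>V. \<Sum>w\<in>V. f u w) = 0" by linarith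
  have "(\<Sum>u\<in>V. \<sigma> u * (s - (M u u)\<^sup>2)) = (\<Sum>u\<in>V. \<Sum>w\<in>V. f u w)"
  proof (rule sum.cong[OF refl])
    fix u assume u: "u \<in> V"
    have "(\<Sum>w\<in>V. f u w) = (\<Sum>w\<in>V-{u}. \<sigma> u * (M u w)\<^sup>2)"
      by (rule sum.mono_neutral_cong_right) (use finite_V in \<open>auto simp: f_def\<close>)
    then show "\<sigma> u * (s - (M u u)\<^sup>2) = (\<Sum>w\<in>V. f u w)"
      using row[OF u] by (simp add: sum_distrib_left)
  qed
  then have "(\<Sum>u\<in>V. \<sigma> u * (s - (M u u)\<^sup>2)) = 0" using f0 by simp
  then have "(\<Sum>u\<in>V. \<sigma> u) * (s - (M r r)\<^sup>2) = 0"
    using sq by (simp add: sum_distrib_right)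
  moreover have "(\<Sum>u\<in>V. \<sigma> u) \<noteq> 0"
  proof -
    \<comment> \<open>A sum of signs has the parity of the number of its terms; the integers make
      parity available.\<close>
    have "odd (\<Sum>u\<in>W. (-1) ^ level r u :: int) \<longleftrightarrow> odd (card W)" if "finite W" for W
      using that by (induction W) auto
    then have "(\<Sum>u\<in>V. (-1) ^ level r u :: int) \<noteq> 0" using odd_card finite_V by fastforce
    moreover have "(\<Sum>u\<in>V. \<sigma> u) = of_int (\<Sum>u\<in>V. (-1) ^ level r u)" by (simp add: \<sigma>_def)
    ultimately show ?thesis by (metis of_int_eq_0_iff)
  qed
  ultimately have "(\<Sum>w\<in>V - {r}. (M r w)\<^sup>2) = 0" using row[OF r] by simp
  then have "\<forall>w\<in>V - {r}. (M r w)\<^sup>2 = 0"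
    by (subst sum_nonneg_eq_0_iff[symmetric]) (use finite_V in auto)
  moreover obtain w where "w \<sim> r" using neighbours_nonempty[OF r] by (auto simp: neighbours_def)
  ultimately show False using M_nonzero_iff[of r w] r adjacent_in_V adjacent_sym adjacent_irrefl
    by (metis Diff_iff singletonD zero_eq_power2)
qed

lemma intra_cards:
  assumes r: "r \<in> V"
  shows "card (intra r) \<ge> 2" 
proof -
  obtain x y where xy: "(x, y) \<in> intra r" using intra_nonempty[OF r] by auto
  then have "x \<noteq> y" "(y, x) \<in> intra r" using intra_sym adjacent_irrefl by (auto simp: intra_def)
  then show ?thesis using card_mono[of "intra r" "{(x, y), (y, x)}"] xy by auto
qed

lemma degree_ge_2:
  assumes "u \<in> V" shows "card (neighbours u) \<ge> 2"
  using intra_cards[OF assms] degree_formula[OF assms] by linarith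

section \<open>The last layer, twins and common upward neighbours\<close>

definition top_level :: "'a \<Rightarrow> nat" where
  "top_level r = Max (level r ` V)"

lemma level_le_top: "u \<in> V \<Longrightarrow> level r u \<le> top_level r"
  unfolding top_level_def using finite_V by simp

lemma top_layer_nonempty: "layer r (top_level r) \<noteq> {}"
proof -
  have "V \<noteq> {}" using odd_card by auto
  then have "top_level r \<in> level r ` V" unfolding top_level_def using finite_V by (intro Max_in) auto
  then show ?thesis by (auto simp: layer_def)
qed

lemma intra_neq: "(x, y) \<in> intra r \<Longrightarrow> x \<noteq> y"
  using adjacent_irrefl by (auto simp: intra_def)

lemma intra_level: "(x, y) \<in> intra r \<Longrightarrow> level r x = level r y \<and> x \<sim> y \<and> x \<in> V \<and> y \<in> V"
  using adjacent_in_V by (auto simp: intra_def)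

lemma neighbours_split:
  assumes r: "r \<in> V"
  shows "neighbours u = down r u \<union> {v. (v, u) \<in> intra r} \<union> {v. u \<in> down r v}"
proof (intro Set.set_eqI iffI)
  fix v assume "v \<in> neighbours u"
  then have "v \<sim> u" "u \<sim> v" using adjacent_commute by (auto simp: neighbours_def)
  from r this(1) show "v \<in> down r u \<union> {v. (v, u) \<in> intra r} \<union> {v. u \<in> down r v}"
    by (cases rule: adjacent_levels_cases) (use \<open>v \<sim> u\<close> \<open>u \<sim> v\<close> in \<open>auto simp: down_def intra_def\<close>)
qed (auto simp: neighbours_def down_def intra_def adjacent_commute)

lemma neighbours_no_up:
  assumes r: "r \<in> V" and no_up: "\<And>v. u \<notin> down r v" and no_intra: "\<And>v. (v, u) \<notin> intra r"
  shows "neighbours u = down r u"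
  using neighbours_split[OF r] assms by auto

lemma card_down_le_2:
  assumes r: "r \<in> V" and ex: "excess r = 0" and u: "u \<in> V"
  shows "card (down r u) \<le> 2"
proof -
  consider "level r u = 0" | "level r u = 1" | "level r u \<ge> 2" by linarith
  then show ?thesis
    using down_level_1[OF r u] excess_0_iff[OF r] ex u by cases (auto simp: down_def)
qed

text \<open>Otherwise a second common neighbour \<open>t\<close> of \<open>z\<close> and
  \<open>y\<close> closes a 4-cycle in which only the edge from \<open>x\<close> to \<open>y\<close>
  stays in its layer; three level changes by one cannot add up to zero.\<close>

lemma twins_if_single_intra:
  assumes r: "r \<in> V" and intra: "intra r = {(x, y), (y, x)}" and z: "z \<sim> x" "z \<noteq> y"
  shows "z \<sim> y"
proof (rule ccontr)
  assume "\<not> z \<sim> y"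
  have xy: "x \<sim> y" "level r x = level r y" "x \<noteq> y" using intra_level[of x y r] intra_neq[of x y r] intra by auto
  obtain t where t: "t \<noteq> x" "t \<sim> z" "t \<sim> y"
    using another_common_neighbour[of z y x] \<open>\<not> z \<sim> y\<close> z xy adjacent_in_V adjacent_sym by blast
  have "z \<noteq> x" "t \<noteq> y" "z \<noteq> t" using z t adjacent_irrefl by blast+
  then have "(z, x) \<notin> intra r" "(t, y) \<notin> intra r" "(t, z) \<notin> intra r"
    using intra xy t z by auto
  then have "level r z \<noteq> level r x" "level r t \<noteq> level r y" "level r t \<noteq> level r z"
    using z t by (simp_all add: intra_def)
  then show False
    using adjacent_levels[OF r z(1)] adjacent_levels[OF r t(2)] adjacent_levels[OF r t(3)] xy(2) by arith
qed

text \<open>Without a common neighbour further out, \<open>z\<close> and \<open>z'\<close> have the same two downward neighbours.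
  Orthogonality to a vertex two layers below makes their columns parallel on these two rows, so
  the columns of \<open>z\<close> and \<open>z'\<close> cannot be orthogonal.\<close>

lemma common_up_neighbour:
  assumes r: "r \<in> V" and ex: "excess r = 0" and i: "i \<ge> 1"
    and z: "z \<in> layer r i" "z' \<in> layer r i" "z \<noteq> z'"
    and share: "down r z \<inter> down r z' \<noteq> {}"
    and no_intra: "(z, z') \<notin> intra r" "\<And>t. (t, z) \<in> intra r \<Longrightarrow> (t, z') \<notin> intra r"
  shows "\<exists>u. z \<in> down r u \<and> z' \<in> down r u"
proof (rule ccontr)
  assume no: "\<nexists>u. z \<in> down r u \<and> z' \<in> down r u"
  have zV: "z \<in> V" "z' \<in> V" "level r z = i" "level r z' = i" using z by (auto simp: layer_def)
  have nonadj: "\<not> z \<sim> z'" using no_intra(1) zV by (auto simp: intra_def)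
  have common: "{w. w \<sim> z \<and> w \<sim> z'} = down r z \<inter> down r z'"
  proof (intro Set.set_eqI iffI)
    fix w assume w: "w \<in> {w. w \<sim> z \<and> w \<sim> z'}"
    then have "level r w \<noteq> i" "level r w \<noteq> Suc i"
      using no_intra(2)[of w] no zV adjacent_commute by (auto simp: intra_def down_def)
    then show "w \<in> down r z \<inter> down r z'"
      using w zV adjacent_levels[OF r, of w z] by (auto simp: down_def)
  qed (auto simp: down_def)
  have sum0: "(\<Sum>w\<in>down r z \<inter> down r z'. M z w * M w z') = 0"
    using sum_common_neighbours[OF zV(1,2) z(3) nonadj] common by simp
  obtain p where p: "p \<in> down r z" "p \<in> down r z'" using share by auto
  have padj: "p \<sim> z" "p \<sim> z'" "p \<in> V" using p adjacent_in_V by (auto simp: down_def)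
  have not_single: "down r z \<inter> down r z' \<noteq> {p}"
  proof
    assume "down r z \<inter> down r z' = {p}"
    then have "M z p * M p z' = 0" using sum0 by simp
    then show False using adjacent_M_nonzero padj adjacent_commute by simp
  qed
  have i2: "i \<ge> 2"
  proof (rule ccontr)
    assume "\<not> i \<ge> 2"
    then have "i = 1" using i by simp
    then have "down r z = {r}" "down r z' = {r}" using down_level_1[OF r] zV by auto
    then show False using not_single p by auto
  qed
  then have c2: "card (down r z) = 2" "card (down r z') = 2"
    using excess_0_iff[OF r] ex zV by auto
  have "card (down r z - {p}) = 1" using c2(1) p(1) by simp
  then obtain p' where "down r z - {p} = {p'}" by (rule card_1_singletonE)
  then have p': "down r z = {p, p'}" "p \<noteq> p'" using p(1) by auto
  have "p' \<in> down r z'" using not_single p' p by auto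
  then have "{p, p'} \<subseteq> down r z'" using p by auto
  then have "{p, p'} = down r z'" using c2(2) p'(2) by (intro card_subset_eq) auto
  then have eq: "down r z' = {p, p'}" by simp
  have p'adj: "p' \<sim> z" "p' \<sim> z'" using p' eq by (auto simp: down_def)
  obtain k where k: "i = Suc (Suc k)" using i2 by (metis add_2_eq_Suc le_Suc_ex)
  have lp: "level r p = Suc k" "level r p' = Suc k" using p' zV k by (auto simp: down_def)
  obtain u where u: "u \<in> down r p" using down_nonempty[OF r padj(3) lp(1)] .
  then have lu: "level r u = k" "u \<sim> p" "u \<in> V" using lp adjacent_in_V by (auto simp: down_def)
  \<comment> \<open>For \<open>v\<close> equal to \<open>z\<close> or \<open>z'\<close>, the common
    neighbours of \<open>u\<close> and \<open>v\<close> are exactly \<open>p\<close> and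
    \<open>p'\<close>, so the vanishing entry of M^2 has two terms.\<close>
  have rel: "u \<sim> p' \<and> M u p * M p v + M u p' * M p' v = 0"
    if v: "v \<in> V" "level r v = i" "down r v = {p, p'}" "p \<sim> v" for v
  proof -
    have nuv: "\<not> u \<sim> v" "u \<noteq> v" using level_step[OF r, of u v] lu v k by auto
    have sub: "{w. w \<sim> u \<and> w \<sim> v} \<subseteq> {p, p'}"
    proof
      fix w assume w: "w \<in> {w. w \<sim> u \<and> w \<sim> v}"
      then have "level r w = Suc k"
        using level_step[OF r, of w v] level_step[OF r, of u w] adjacent_commute lu v(2) k by fastforce
      then have "w \<in> down r v" using w v k by (auto simp: down_def)
      then show "w \<in> {p, p'}" using v by simp
    qed
    obtain x where "x \<noteq> p" "x \<sim> u" "x \<sim> v"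
      using another_common_neighbour[OF lu(3) v(1) nuv(2,1), of p] lu v(4) adjacent_sym by blast
    then have "p' \<sim> u" using sub by auto
    moreover have "p' \<sim> v" using v(3) by (auto simp: down_def)
    ultimately have "{w. w \<sim> u \<and> w \<sim> v} = {p, p'}" using sub lu(2) v(4) adjacent_commute by auto
    then show ?thesis
      using sum_common_neighbours[OF lu(3) v(1) nuv(2,1)] p'(2) \<open>p' \<sim> u\<close> adjacent_commute by simp
  qed
  have E: "M u p * M p z + M u p' * M p' z = 0" "M u p * M p z' + M u p' * M p' z' = 0" "M u p' \<noteq> 0"
    using rel[of z] rel[of z'] zV p' eq padj adjacent_M_nonzero by auto
  have "M z p * M p z' + M z p' * M p' z' = 0"
    using sum0 p' eq by simp
  then have S: "M p z * M p z' + M p' z * M p' z' = 0"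
    using M_sym zV adjacent_in_V padj p'adj by metis
  \<comment> \<open>Inserting both relations of \<open>E\<close> into \<open>S\<close> times
    \<open>(M u p')\<^sup>2\<close> leaves a factor that is a sum of two squares.\<close>
  have "M p z * M p z' * ((M u p')\<^sup>2 + (M u p)\<^sup>2) = 0"
  proof -
    have "(M u p')\<^sup>2 * (M p' z * M p' z') = (M u p' * M p' z) * (M u p' * M p' z')"
      by (simp add: power2_eq_square)
    also have "\<dots> = (M u p)\<^sup>2 * (M p z * M p z')"
      using E(1,2) by (simp add: eq_neg_iff_add_eq_0[symmetric] add.commute power2_eq_square)
    finally have "(M u p')\<^sup>2 * (M p' z * M p' z') = (M u p)\<^sup>2 * (M p z * M p z')" .
    moreover have "(M u p')\<^sup>2 * (M p z * M p z' + M p' z * M p' z') = 0" using S by simp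
    ultimately show ?thesis by (simp add: algebra_simps)
  qed
  moreover have "(M u p')\<^sup>2 + (M u p)\<^sup>2 \<noteq> 0" using E(3) by (simp add: sum_power2_eq_zero_iff)
  ultimately show False using adjacent_M_nonzero padj by simp
qed

section \<open>Triples that climb from layer to layer\<close>

text \<open>Only pairwise overlap is required, because this is what is inherited one layer
  up.\<close>

definition triple :: "'a \<Rightarrow> nat \<Rightarrow> 'a \<Rightarrow> 'a \<Rightarrow> 'a \<Rightarrow> bool" where
  "triple r i a b c \<longleftrightarrow> {a, b, c} \<subseteq> layer r i \<and> a \<noteq> b \<and> b \<noteq> c \<and> a \<noteq> c
    \<and> down r a \<inter> down r b \<noteq> {} \<and> down r b \<inter> down r c \<noteq> {} \<and> down r a \<inter> down r c \<noteq> {}"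

text \<open>With no excess, a vertex above two of the three has exactly these two below it. The
  three pairs are distinct, and any two of them meet.\<close>

lemma triple_up:
  assumes r: "r \<in> V" and ex: "excess r = 0" and i: "i \<ge> 1" and tr: "triple r i a b c"
    and up: "\<And>z z'. z \<in> {a, b, c} \<Longrightarrow> z' \<in> {a, b, c} \<Longrightarrow> z \<noteq> z' \<Longrightarrow> \<exists>u. z \<in> down r u \<and> z' \<in> down r u"
  shows "\<exists>a' b' c'. triple r (Suc i) a' b' c' \<and> inj_on (down r) {a', b', c'}"
proof -
  have abc: "a \<noteq> b" "b \<noteq> c" "a \<noteq> c" "{a, b, c} \<subseteq> layer r i" using tr by (auto simp: triple_def)
  have down_eq: "down r u = {z, z'} \<and> u \<in> layer r (Suc i)"
    if "z \<in> down r u" "z' \<in> down r u" "z \<noteq> z'" "z \<in> {a, b, c}" for z z' u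
  proof -
    have "z \<sim> u" "level r u = Suc (level r z)" using that by (auto simp: down_def)
    then have u: "u \<in> V" "level r u = Suc i" using that(4) abc(4) adjacent_in_V by (auto simp: layer_def)
    then have "card (down r u) = 2" using excess_0_iff[OF r] ex i by auto
    moreover have "card {z, z'} = 2" using that by simp
    ultimately have "{z, z'} = down r u" using that by (intro card_subset_eq) auto
    then show ?thesis using u by (simp add: layer_def)
  qed
  obtain u where u: "a \<in> down r u" "b \<in> down r u" using up[of a b] abc by auto
  obtain v where v: "b \<in> down r v" "c \<in> down r v" using up[of b c] abc by auto
  obtain w where w: "a \<in> down r w" "c \<in> down r w" using up[of a c] abc by auto
  have d: "down r u = {a, b}" "down r v = {b, c}" "down r w = {a, c}"
    "{u, v, w} \<subseteq> layer r (Suc i)"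
    using down_eq[OF u] down_eq[OF v] down_eq[OF w] abc by auto
  have n: "{a, b} \<noteq> {b, c}" "{a, b} \<noteq> {a, c}" "{b, c} \<noteq> {a, c}" using abc by auto
  then have "u \<noteq> v" "v \<noteq> w" "u \<noteq> w" using d by metis+
  then have "triple r (Suc i) u v w" "inj_on (down r) {u, v, w}"
    using d n by (auto simp: triple_def inj_on_def)
  then show ?thesis by blast
qed

lemma obtain_three:
  assumes "card A \<ge> 3"
  obtains a b c where "{a, b, c} \<subseteq> A" "a \<noteq> b" "b \<noteq> c" "a \<noteq> c"
proof -
  obtain T where "T \<subseteq> A" "card T = 3" using obtain_subset_with_card_n[OF assms] by blast
  then show ?thesis using that by (auto simp: card_3_iff)
qed

lemma card_intra_2:
  assumes "card (intra r) = 2"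
  obtains x y where "intra r = {(x, y), (y, x)}" "x \<noteq> y"
proof -
  have "intra r \<noteq> {}" using assms by auto
  then obtain x y where xy: "(x, y) \<in> intra r" by auto
  then have "(y, x) \<in> intra r" "x \<noteq> y" using intra_sym intra_neq by blast+
  then have "{(x, y), (y, x)} = intra r" using xy assms by (intro card_subset_eq) auto
  then show ?thesis using that[of x y] \<open>x \<noteq> y\<close> by simp
qed

text \<open>Take \<open>x\<close> as root. The edges from \<open>y\<close> to the other neighbours
  of \<open>x\<close> already use up all the slack, so there is no excess and no further edge inside
  a layer; a vertex of the last layer then has degree 2.\<close>

lemma adjacent_twins_degree_2:
  assumes xy: "x \<sim> y" and twins: "\<And>z. z \<noteq> x \<Longrightarrow> z \<noteq> y \<Longrightarrow> z \<sim> x \<longleftrightarrow> z \<sim> y"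
  shows "\<exists>u\<in>V. card (neighbours u) = 2"
proof -
  have V: "x \<in> V" "y \<in> V" "x \<noteq> y" using xy adjacent_in_V adjacent_irrefl by blast+
  define P where "P = neighbours x - {y}"
  have yP: "y \<in> neighbours x" using xy adjacent_commute by (simp add: neighbours_def)
  then have cP: "card (neighbours x) = Suc (card P)" unfolding P_def by (metis card.remove finite_neighbours)
  have finP: "finite P" by (simp add: P_def)
  let ?I = "{y} \<times> P \<union> P \<times> {y}"
  have lev1: "level x u = 1" if "u \<in> neighbours x" for u
    using that layer_1[OF V(1)] by (auto simp: layer_def)
  have sub: "?I \<subseteq> intra x"
  proof -
    have "(y, p) \<in> intra x" if "p \<in> P" for p
      using that lev1[of p] lev1[OF yP] twins[of p] adjacent_commute adjacent_irrefl
      unfolding P_def intra_def neighbours_def by auto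
    then show ?thesis using intra_sym by blast
  qed
  have cI: "card ?I = 2 * card P"
    by (subst card_Un_disjoint) (use finP in \<open>auto simp: P_def card_cartesian_product\<close>)
  have "card ?I \<le> card (intra x)" using sub by (rule card_mono[OF finite_intra])
  then have ex: "excess x = 0" and "card (intra x) = card ?I"
    using degree_formula[OF V(1)] cI cP by auto
  then have intra: "intra x = ?I" using card_subset_eq[OF finite_intra sub] by simp
  obtain u where u: "u \<in> V" "level x u = top_level x"
    using top_layer_nonempty[of x] by (auto simp: layer_def)
  show ?thesis
  proof (cases "top_level x \<ge> 2")
    case True
    have "neighbours u = down x u"
    proof (rule neighbours_no_up[OF V(1)])
      show "u \<notin> down x v" for v
        using level_le_top[of v x] u adjacent_in_V by (fastforce simp: down_def)
      show "(v, u) \<notin> intra x" for v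
        using lev1[of u] lev1[OF yP] True u unfolding intra P_def by auto
    qed
    moreover have "card (down x u) = 2" using excess_0_iff[OF V(1)] ex u True by simp
    ultimately show ?thesis using u(1) by metis
  \<comment> \<open>With no layer beyond the first, a neighbour \<open>p\<close> of \<open>x\<close>
    other than \<open>y\<close> is adjacent to \<open>x\<close> and \<open>y\<close> only.\<close>
  next
    case False
    have "card P \<noteq> 0" using degree_ge_2[OF V(1)] cP by simp
    then obtain p where p: "p \<in> P" by fastforce
    have pV: "p \<in> V" "p \<noteq> y" "level x p = 1" using p lev1 adjacent_in_V by (auto simp: P_def neighbours_def)
    have "neighbours p = down x p \<union> {v. (v, p) \<in> intra x} \<union> {v. p \<in> down x v}"
      by (rule neighbours_split[OF V(1)])
    moreover have "{v. p \<in> down x v} = {}"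
      using level_le_top[of _ x] pV False adjacent_in_V by (fastforce simp: down_def)
    moreover have "{v. (v, p) \<in> intra x} = {y}" using p pV unfolding intra by auto
    ultimately have "neighbours p = {x, y}" using down_level_1[OF V(1)] pV by auto
    then show ?thesis using pV V by (intro bexI[of _ p]) auto
  qed
qed

text \<open>The neighbours of \<open>r\<close> form the first triple, sharing \<open>r\<close>. It
  climbs as long as the layers passed contain no edge. Injectivity fails in layer 1, where all
  downward sets are \<open>{r}\<close>.\<close>

lemma triple_exists:
  assumes r: "r \<in> V" and ex: "excess r = 0" and deg: "card (neighbours r) = 3" and i: "i \<ge> 1"
    and intra: "\<And>u v. (u, v) \<in> intra r \<Longrightarrow> level r u \<ge> i"
  shows "\<exists>a b c. triple r i a b c \<and> (i \<ge> 2 \<longrightarrow> inj_on (down r) {a, b, c})"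
  using i intra
proof (induction i rule: dec_induct)
  case base
  obtain a b c where abc: "{a, b, c} \<subseteq> neighbours r" "a \<noteq> b" "b \<noteq> c" "a \<noteq> c"
    using obtain_three[of "neighbours r"] deg by auto
  then have "down r z = {r}" if "z \<in> {a, b, c}" for z
    using that layer_1[OF r] down_level_1[OF r] by (auto simp: layer_def)
  then have "triple r 1 a b c" using abc layer_1[OF r] unfolding triple_def by auto
  then show ?case by auto
next
  case (step i)
  then obtain a b c where abc: "triple r i a b c" by (meson Suc_leD)
  have "\<exists>u. z \<in> down r u \<and> z' \<in> down r u"
    if z: "z \<in> {a, b, c}" "z' \<in> {a, b, c}" "z \<noteq> z'" for z z'
  proof (rule common_up_neighbour[OF r ex step.hyps(1)])
    show zl: "z \<in> layer r i" "z' \<in> layer r i" using abc z by (auto simp: triple_def)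
    show "down r z \<inter> down r z' \<noteq> {}" using abc z by (auto simp: triple_def)
    have *: "(t, z) \<notin> intra r" if "z \<in> layer r i" for t z
      using step.prems[of z t] intra_sym[of t z r] that by (auto simp: layer_def)
    show "(z, z') \<notin> intra r" "\<And>t. (t, z) \<in> intra r \<Longrightarrow> (t, z') \<notin> intra r"
      using * zl by blast+
  qed (use z in auto)
  from triple_up[OF r ex step.hyps(1) abc this] show ?case by auto
qed

lemma not_intra_level: "(u, v) \<notin> intra r \<Longrightarrow> u \<sim> v \<Longrightarrow> level r u \<noteq> level r v"
  by (simp add: intra_def)

section \<open>A root of degree two\<close>

text \<open>The conclusion describes adjacency purely by levels, the form needed to build the
  isomorphism; its last disjunct is the closing edge of the candle.\<close>

lemma candle_layers:
  assumes r: "r \<in> V" and deg: "card (neighbours r) = 2"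
  shows "\<exists>h\<ge>1. card V = 2 * h + 1 \<and> (\<forall>u\<in>V. level r u \<le> h) \<and> (\<forall>i. 1 \<le> i \<and> i \<le> h \<longrightarrow> card (layer r i) = 2)
    \<and> (\<forall>u\<in>V. \<forall>v\<in>V. u \<sim> v \<longleftrightarrow> Suc (level r u) = level r v \<or> Suc (level r v) = level r u
          \<or> (level r u = h \<and> level r v = h \<and> u \<noteq> v))"
proof -
  have ex: "excess r = 0" and ci: "card (intra r) = 2"
    using degree_formula[OF r] intra_cards[OF r] deg by auto
  obtain x y where intra: "intra r = {(x, y), (y, x)}" "x \<noteq> y" using card_intra_2[OF ci] .
  have up: "\<exists>u. z \<in> down r u \<and> z' \<in> down r u"
    if "i \<ge> 1" "z \<in> layer r i" "z' \<in> layer r i" "z \<noteq> z'" "down r z \<inter> down r z' \<noteq> {}" "(z, z') \<notin> intra r"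
    for i z z'
    by (rule common_up_neighbour[OF r ex that]) (use that(4) intra in auto)
  \<comment> \<open>If the edge inside a layer joined \<open>a\<close> and \<open>b\<close>, a
    vertex above \<open>a\<close> and \<open>c\<close> would by twinship also be above
    \<open>b\<close>, giving it three downward neighbours.\<close>
  have triple_not_intra: "(a, b) \<notin> intra r" if i: "i \<ge> 1" and tr: "triple r i a b c" for i a b c
  proof
    assume ab: "(a, b) \<in> intra r"
    have abc: "a \<noteq> b" "b \<noteq> c" "a \<noteq> c" "a \<in> layer r i" "b \<in> layer r i" "c \<in> layer r i"
      "down r a \<inter> down r c \<noteq> {}"
      using tr by (auto simp: triple_def)
    have iab: "intra r = {(a, b), (b, a)}" using ab intra by auto
    obtain u where u: "a \<in> down r u" "c \<in> down r u"
      using up[OF i abc(4,6,3,7)] iab abc by auto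
    have lu: "level r u = Suc i" "u \<sim> a" "u \<in> V"
      using u abc adjacent_commute adjacent_in_V by (auto simp: down_def layer_def)
    have "u \<noteq> b" using lu abc by (auto simp: layer_def)
    then have "u \<sim> b" using twins_if_single_intra[OF r iab lu(2)] by simp
    then have "{a, b, c} \<subseteq> down r u" using u lu abc adjacent_commute by (auto simp: down_def layer_def)
    then have "card {a, b, c} \<le> card (down r u)" by (intro card_mono) auto
    then show False using card_down_le_2[OF r ex lu(3)] abc by simp
  qed
  \<comment> \<open>A triple would climb past the last layer.\<close>
  have no_triple: "\<not> triple r i a b c" if i: "i \<ge> 1" for i a b c
  proof
    assume tr: "triple r i a b c"
    have "\<exists>a b c. triple r (i + j) a b c" for j
    proof (induction j)
      case 0
      then show ?case using tr by auto
    next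
      case (Suc j)
      then obtain a b c where abc: "triple r (i + j) a b c" by blast
      have ij: "i + j \<ge> 1" using i by simp
      have perms: "triple r (i + j) b a c" "triple r (i + j) a c b" "triple r (i + j) c a b"
        "triple r (i + j) b c a" "triple r (i + j) c b a"
        using abc by (auto simp: triple_def Int_commute)
      note ni = triple_not_intra[OF ij abc] perms[THEN triple_not_intra[OF ij]]
      have "\<exists>u. z \<in> down r u \<and> z' \<in> down r u"
        if z: "z \<in> {a, b, c}" "z' \<in> {a, b, c}" "z \<noteq> z'" for z z'
        by (rule up[OF ij]) (use abc z ni in \<open>auto simp: triple_def\<close>)
      from triple_up[OF r ex ij abc this] show ?case by auto
    qed
    then obtain a b c where "triple r (i + top_level r) a b c" by blast
    then have "a \<in> V" "level r a = i + top_level r" by (auto simp: triple_def layer_def)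
    then show False using level_le_top[of a r] i by simp
  qed
  have card_le_2: "card (layer r i) \<le> 2"
    if i: "i \<ge> 1" and same: "\<And>u. u \<in> layer r i \<Longrightarrow> down r u = D" and D: "D \<noteq> {}" for i D
  proof (rule ccontr)
    assume "\<not> card (layer r i) \<le> 2"
    then obtain a b c where abc: "{a, b, c} \<subseteq> layer r i" "a \<noteq> b" "b \<noteq> c" "a \<noteq> c"
      using obtain_three[of "layer r i"] by auto
    then have "triple r i a b c" using same D by (auto simp: triple_def)
    then show False using no_triple[OF i] by simp
  qed
  \<comment> \<open>A vertex of the next layer has two downward neighbours in a layer of at most
    two, hence all of it; so the next layer has a common downward set and at most two
    vertices.\<close>
  have layers: "card (layer r i) \<le> 2 \<and> (\<forall>u\<in>layer r i. down r u = layer r (i - 1))" if "i \<ge> 1" for i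
    using that
  proof (induction i rule: dec_induct)
    case base
    then show ?case using layer_1[OF r] deg down_level_1[OF r] layer_0[OF r] by (auto simp: layer_def)
  next
    case (step i)
    have dl: "down r u = layer r i" if u: "u \<in> layer r (Suc i)" for u
    proof -
      have "card (down r u) = 2" using excess_0_iff[OF r] ex u step.hyps(1) by (auto simp: layer_def)
      moreover have "down r u \<subseteq> layer r i" using down_in_layer[OF r] u by (auto simp: layer_def)
      ultimately show ?thesis using step.IH by (metis card_seteq finite_layer)
    qed
    show ?case
    proof (cases "layer r (Suc i) = {}")
      case True
      then show ?thesis by simp
    next
      case False
      then obtain u where u: "u \<in> layer r (Suc i)" by blast
      then have "card (down r u) = 2" using excess_0_iff[OF r] ex step.hyps(1) by (auto simp: layer_def)
      then have "layer r i \<noteq> {}" using dl[OF u] by auto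
      then show ?thesis using card_le_2[of "Suc i" "layer r i"] dl by simp
    qed
  qed
  define h where "h = top_level r"
  have top: "level r u \<le> h" if "u \<in> V" for u using level_le_top that h_def by simp
  \<comment> \<open>This descends from the last layer; once the subtraction truncates, it only
    repeats the root layer.\<close>
  have nonempty: "layer r (h - j) \<noteq> {}" for j
  proof (induction j)
    case 0
    then show ?case using top_layer_nonempty h_def by simp
  next
    case (Suc j)
    then obtain u where u: "u \<in> layer r (h - j)" by blast
    show ?case
    proof (cases "h - j")
      case 0
      then show ?thesis using Suc by simp
    next
      case (Suc k)
      obtain p where "p \<in> down r u" using down_nonempty[OF r, of u k] u Suc by (auto simp: layer_def)
      then have "p \<in> layer r k" using down_in_layer[OF r] u Suc by (auto simp: layer_def)
      then show ?thesis using Suc by (metis Suc_diff_Suc diff_Suc_1 diff_Suc_eq_diff_pred diff_commute empty_iff)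
    qed
  qed
  have below: "card (layer r i) = 2" if "1 \<le> i" "i < h" for i
  proof -
    have "h - (h - Suc i) = Suc i" using that by simp
    then obtain u where u: "u \<in> layer r (Suc i)" using nonempty[of "h - Suc i"] by auto
    then have "card (down r u) = 2" using excess_0_iff[OF r] ex that by (auto simp: layer_def)
    moreover have "down r u = layer r i" using layers[of "Suc i"] u by simp
    ultimately show ?thesis by simp
  qed
  have h1: "h \<ge> 1"
  proof -
    obtain u where u: "u \<in> neighbours r" using deg by fastforce
    then have "u \<in> layer r 1" using layer_1[OF r] by simp
    then show ?thesis using top[of u] by (auto simp: layer_def)
  qed
  have cV: "card V = 1 + 2 * (h - 1) + card (layer r h)"
  proof -
    have V: "V = (\<Union>i\<in>{..h}. layer r i)" using top by (auto simp: layer_def)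
    have "card V = (\<Sum>i\<in>{..h}. card (layer r i))"
      by (subst V, rule card_UN_disjoint) (simp_all, auto simp: layer_def)
    also have "{..h} = insert 0 (insert h {1..<h})" using h1 by auto
    also have "(\<Sum>i\<in>\<dots>. card (layer r i)) = 1 + 2 * (h - 1) + card (layer r h)"
      using h1 below by (simp add: layer_0[OF r])
    finally show ?thesis .
  qed
  \<comment> \<open>Oddness of the vertex count enters here: it excludes a last layer with a single
    vertex.\<close>
  then have "even (card (layer r h))" using odd_card by simp
  moreover have "card (layer r h) \<noteq> 0" using nonempty[of 0] by simp
  ultimately have ch: "card (layer r h) = 2"
    using layers[OF h1] by (metis One_nat_def even_numeral le_antisym le_neq_implies_less less_2_cases odd_one)
  then obtain z z' where z: "layer r h = {z, z'}" "z \<noteq> z'" by (auto simp: card_2_iff)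
  \<comment> \<open>Otherwise \<open>z\<close> and \<open>z'\<close>, which share the layer below,
    would have a common neighbour above the last layer.\<close>
  have zz: "(z, z') \<in> intra r"
  proof (rule ccontr)
    assume nz: "(z, z') \<notin> intra r"
    have "down r z \<inter> down r z' = layer r (h - 1)" using layers[OF h1] z by auto
    then obtain u where "z \<in> down r u" using up[OF h1 _ _ z(2) _ nz] z nonempty[of 1] by auto
    moreover have "level r z = h" using z by (auto simp: layer_def)
    ultimately show False using top[of u] adjacent_in_V by (auto simp: down_def)
  qed
  then have izz: "intra r = {(z, z'), (z', z)}" using intra by auto
  have up_adj: "u \<sim> v" if "u \<in> V" "v \<in> V" "Suc (level r u) = level r v" for u v
  proof -
    have "down r v = layer r (level r u)" using layers[of "level r v"] that by (auto simp: layer_def)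
    then show ?thesis using that by (auto simp: layer_def down_def)
  qed
  have adj: "u \<sim> v \<longleftrightarrow> Suc (level r u) = level r v \<or> Suc (level r v) = level r u
          \<or> (level r u = h \<and> level r v = h \<and> u \<noteq> v)" if uv: "u \<in> V" "v \<in> V" for u v
  proof
    assume "u \<sim> v"
    moreover have "level r u = h \<and> level r v = h \<and> u \<noteq> v" if "(u, v) \<in> intra r"
      using that z unfolding izz layer_def by auto
    ultimately show "Suc (level r u) = level r v \<or> Suc (level r v) = level r u
          \<or> (level r u = h \<and> level r v = h \<and> u \<noteq> v)"
      using adjacent_levels[OF r, of u v] by (auto simp: intra_def)
  next
    assume "Suc (level r u) = level r v \<or> Suc (level r v) = level r u
          \<or> (level r u = h \<and> level r v = h \<and> u \<noteq> v)"
    moreover have "u \<sim> v" if "level r u = h \<and> level r v = h \<and> u \<noteq> v"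
    proof -
      have "{u, v} \<subseteq> {z, z'}" using that uv z(1) by (auto simp: layer_def)
      then have "(u, v) \<in> intra r" using that izz by auto
      then show ?thesis by (simp add: intra_def)
    qed
    ultimately show "u \<sim> v" using up_adj uv adjacent_sym by blast
  qed
  have all2: "card (layer r i) = 2" if "1 \<le> i" "i \<le> h" for i
    using below ch that by (cases "i = h") auto
  show ?thesis
    using h1 cV ch top all2 adj by (intro exI[of _ h]) auto
qed

section \<open>Excluding minimum degree three\<close>

text \<open>Two edges inside layers must serve every vertex without upward neighbours. If they share
  a vertex of the last layer, the layer below is too small for a triple. Otherwise they form
  opposite sides of a 4-cycle across the last two layers, which fails by parity or by injectivity of
  the triple.\<close>

lemma no_two_intra_edges:
  assumes r: "r \<in> V" and deg: "card (neighbours r) = 3" and ex: "excess r = 0"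
    and ci: "card (intra r) = 4" and deg3: "\<And>u. u \<in> V \<Longrightarrow> card (neighbours u) \<ge> 3"
  shows False
proof -
  define h where "h = top_level r"
  have top: "level r u \<le> h" if "u \<in> V" for u using level_le_top that h_def by simp
  have rV: "r \<notin> neighbours r" using adjacent_irrefl by (auto simp: neighbours_def)
  have h2: "h \<ge> 2"
  proof (rule ccontr)
    assume "\<not> h \<ge> 2"
    then have "V = layer r 0 \<union> layer r 1" using top by (fastforce simp: layer_def)
    then have "V = insert r (neighbours r)" by (simp add: layer_0[OF r] layer_1[OF r] del: One_nat_def)
    then have "card V = 4" using deg rV by (metis card_insert_disjoint finite_neighbours eval_nat_numeral(2) numeral_3_eq_3 semiring_norm(26,27))
    then show False using odd_card by simp
  qed
  \<comment> \<open>With no upward neighbour and no edge in its layer, a vertex keeps at most two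
    neighbours.\<close>
  have intra_mem: "\<exists>v. (u, v) \<in> intra r" if "u \<in> V" and no_up: "\<And>v. u \<notin> down r v" for u
  proof (rule ccontr)
    assume "\<nexists>v. (u, v) \<in> intra r"
    then have "neighbours u = down r u" using neighbours_no_up[OF r no_up] intra_sym by blast
    then show False using deg3[OF that(1)] card_down_le_2[OF r ex that(1)] by simp
  qed
  have top_intra: "\<exists>v. (u, v) \<in> intra r" if "u \<in> layer r h" for u
    by (rule intra_mem) (use that top adjacent_in_V in \<open>fastforce simp: layer_def down_def\<close>)+
  have down2: "card (down r u) = 2" if "u \<in> V" "level r u \<ge> 2" for u
    using excess_0_iff[OF r] ex that by auto
  \<comment> \<open>Second common neighbours show that \<open>x\<close>, \<open>y\<close>,
    \<open>p\<close> have the same two vertices below them. Every vertex of layer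
    \<open>h - 1\<close> must be one of these, while a triple needs three.\<close>
  have path: False if xy: "(x, y) \<in> intra r" and xp: "(x, p) \<in> intra r" and "y \<noteq> p" and lx: "level r x = h" for x y p
  proof -
    have ne: "x \<noteq> y" "x \<noteq> p" using xy xp intra_neq by blast+
    have lev: "level r y = h" "level r p = h" "x \<in> V" "y \<in> V" "p \<in> V" "x \<sim> y" "x \<sim> p"
      using intra_level[OF xy] intra_level[OF xp] lx by auto
    have "{(x, y), (y, x), (x, p), (p, x)} = intra r"
      by (rule card_subset_eq) (use xy xp ci ne \<open>y \<noteq> p\<close> intra_sym in auto)
    then have intra: "intra r = {(x, y), (y, x), (x, p), (p, x)}" by simp
    have sub: "down r x = down r z" if z: "z \<in> {y, p}" for z
    proof -
      have zl: "level r z = h" "z \<in> V" "x \<sim> z" "z \<noteq> x" using z lev ne by auto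
      have "down r x \<subseteq> down r z"
      proof
        fix d assume d: "d \<in> down r x"
        have ld: "d \<sim> x" "Suc (level r d) = h" "d \<in> V" using d lx adjacent_in_V by (auto simp: down_def)
        have "d \<sim> z"
        proof (rule ccontr)
          assume "\<not> d \<sim> z"
          moreover have "d \<noteq> z" using ld zl by auto
          ultimately obtain t where t: "t \<noteq> x" "t \<sim> d" "t \<sim> z"
            using another_common_neighbour[of d z x] ld zl adjacent_sym by blast
          have "(t, z) \<notin> intra r" using t z ne unfolding intra by auto
          moreover have "(t, d) \<notin> intra r" using ld lx lev unfolding intra by auto
          ultimately have "level r t \<noteq> level r z" "level r t \<noteq> level r d"
            using not_intra_level t(2,3) by blast+
          then show False
            using adjacent_levels[OF r t(2)] adjacent_levels[OF r t(3)] ld(2) zl(1) top[of t] adjacent_in_V[OF t(2)]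
            by arith
        qed
        then show "d \<in> down r z" using ld zl by (simp add: down_def)
      qed
      then show ?thesis using down2[of x] down2[of z] zl lev lx h2 by (intro card_subset_eq) auto
    qed
    have hl: "layer r h \<subseteq> {x, y, p}" using top_intra unfolding intra by auto
    have "layer r (h - 1) \<subseteq> down r x"
    proof
      fix u assume u: "u \<in> layer r (h - 1)"
      show "u \<in> down r x"
      proof (rule ccontr)
        assume nu: "u \<notin> down r x"
        have lu: "u \<in> V" "Suc (level r u) = h" using u h2 by (auto simp: layer_def)
        have "u \<notin> down r v" for v
        proof
          assume v: "u \<in> down r v"
          then have "v \<in> layer r h" using lu adjacent_in_V by (auto simp: down_def layer_def)
          then have "v \<in> {x, y, p}" using hl by blast
          then show False using sub v nu by auto
        qed
        then obtain v where "(u, v) \<in> intra r" using intra_mem[OF lu(1)] by blast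
        then show False using lu lx lev unfolding intra by auto
      qed
    qed
    then have "card (layer r (h - 1)) \<le> 2"
      using card_mono[of "down r x" "layer r (h - 1)"] down2[of x] lev lx h2 by simp
    moreover obtain a b c where "triple r (h - 1) a b c"
      using triple_exists[OF r ex deg, of "h - 1"] h2 lx lev unfolding intra by fastforce
    then have "{a, b, c} \<subseteq> layer r (h - 1)" "card {a, b, c} = 3" by (auto simp: triple_def)
    then have "3 \<le> card (layer r (h - 1))" using card_mono[of "layer r (h - 1)" "{a, b, c}"] by simp
    ultimately show False by simp
  qed
  obtain x0 where x0: "x0 \<in> layer r h" using top_layer_nonempty h_def by blast
  then obtain y0 where xy0: "(x0, y0) \<in> intra r" using top_intra by blast
  \<comment> \<open>Twins would give a vertex of degree 2, so some \<open>p\<close> distinguishes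
    the ends; the names \<open>x\<close> and \<open>y\<close> are then chosen so that
    \<open>p\<close> is adjacent to \<open>x\<close> only.\<close>
  have "\<not> (\<forall>z. z \<noteq> x0 \<longrightarrow> z \<noteq> y0 \<longrightarrow> z \<sim> x0 \<longleftrightarrow> z \<sim> y0)"
    using adjacent_twins_degree_2[of x0 y0] deg3 intra_level[OF xy0] by fastforce
  then obtain p where p0: "p \<noteq> x0" "p \<noteq> y0" "(p \<sim> x0) \<noteq> (p \<sim> y0)" by blast
  have "level r x0 = h" "level r y0 = h" using x0 intra_level[OF xy0] by (auto simp: layer_def)
  with p0 xy0 intra_sym obtain x y
    where xy: "(x, y) \<in> intra r" "level r x = h" and p: "p \<sim> x" "\<not> p \<sim> y" "p \<noteq> y" "p \<noteq> x"
    by (metis (full_types))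
  have lev: "level r y = h" "x \<sim> y" "x \<in> V" "y \<in> V" "p \<in> V" "x \<noteq> y"
    using intra_level[OF xy(1)] intra_neq[OF xy(1)] xy(2) p adjacent_in_V by auto
  obtain t where t: "t \<noteq> x" "t \<sim> p" "t \<sim> y"
    using another_common_neighbour[of p y x] p lev adjacent_sym by blast
  have tV: "t \<in> V" "t \<noteq> y" "t \<noteq> p" using t adjacent_in_V adjacent_irrefl by blast+
  have "(x, p) \<notin> intra r" using path[OF xy(1) _ _ xy(2)] p by blast
  then have lp: "Suc (level r p) = h"
    using adjacent_levels[OF r adjacent_sym[OF p(1)]] top[OF lev(5)] xy(2)
      not_intra_level[of x p r] adjacent_sym[OF p(1)] \<open>(x, p) \<notin> intra r\<close> by auto
  have "(y, t) \<notin> intra r" using path[OF intra_sym[OF xy(1)] _ _ lev(1)] t by blast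
  then have lt: "Suc (level r t) = h"
    using adjacent_levels[OF r adjacent_sym[OF t(3)]] top[OF tV(1)] lev(1)
      not_intra_level[of y t r] adjacent_sym[OF t(3)] \<open>(y, t) \<notin> intra r\<close> by auto
  \<comment> \<open>By \<open>path\<close>, both \<open>p\<close> and \<open>t\<close> lie in layer
    \<open>h - 1\<close>, so their edge is the second one inside a layer.\<close>
  have pt: "(p, t) \<in> intra r" using t lp lt adjacent_commute by (auto simp: intra_def)
  have "{(x, y), (y, x), (p, t), (t, p)} = intra r"
    by (rule card_subset_eq) (use xy pt ci lev p t tV intra_sym in auto)
  then have intra: "intra r = {(x, y), (y, x), (p, t), (t, p)}" by simp
  have hl: "layer r h = {x, y}"
  proof
    show "layer r h \<subseteq> {x, y}"
    proof
      fix u assume u: "u \<in> layer r h"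
      then obtain v where "(u, v) \<in> intra r" using top_intra by blast
      then have "u \<in> {x, y, p, t}" unfolding intra by auto
      moreover have "u \<noteq> p" "u \<noteq> t" using u lp lt by (auto simp: layer_def)
      ultimately show "u \<in> {x, y}" by auto
    qed
  qed (use lev xy(2) in \<open>auto simp: layer_def\<close>)
  \<comment> \<open>A further vertex \<open>u\<close> below \<open>y\<close> but not below
    \<open>x\<close> would share with \<open>x\<close> a second neighbour \<open>w\<close>, forced
    into layer \<open>h - 1\<close> by \<open>x\<close> and out of it by \<open>u\<close>.\<close>
  have "layer r (h - 1) \<subseteq> {p, t} \<union> (down r x - {p})"
  proof
    fix u assume "u \<in> layer r (h - 1)"
    then have u: "u \<in> V" "Suc (level r u) = h" using h2 by (auto simp: layer_def)
    show "u \<in> {p, t} \<union> (down r x - {p})"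
    proof (rule ccontr)
      assume nu: "u \<notin> {p, t} \<union> (down r x - {p})"
      then have "\<nexists>v. (u, v) \<in> intra r" using u lev xy(2) unfolding intra by auto
      then obtain v where v: "u \<in> down r v" using intra_mem[OF u(1)] by blast
      then have "v \<in> layer r h" using u adjacent_in_V by (auto simp: down_def layer_def)
      then have "v = y" using nu v hl by auto
      then have uy: "y \<sim> u" using v adjacent_commute by (simp add: down_def)
      have "\<not> u \<sim> x" using nu u xy(2) by (auto simp: down_def)
      moreover have "u \<noteq> x" using u xy(2) by auto
      ultimately obtain w where w: "w \<noteq> y" "w \<sim> u" "w \<sim> x"
        using another_common_neighbour[of u x y] u lev uy adjacent_sym by blast
      have "(w, u) \<notin> intra r" "(w, x) \<notin> intra r" using w nu lev u xy(2) p lp lt unfolding intra by auto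
      then have "level r w \<noteq> level r u" "level r w \<noteq> level r x"
        using not_intra_level w(2,3) by blast+
      then show False
        using adjacent_levels[OF r w(2)] adjacent_levels[OF r w(3)] u(2) xy(2) top[of w] adjacent_in_V[OF w(2)]
        by arith
    qed
  qed
  moreover have "card (down r x - {p}) = 1"
    using down2[of x] lev xy(2) h2 p lp by (simp add: down_def)
  moreover have "card ({p, t} \<union> (down r x - {p})) \<le> card {p, t} + card (down r x - {p})"
    by (rule card_Un_le)
  ultimately have c3: "card (layer r (h - 1)) \<le> 3"
    using card_mono[of "{p, t} \<union> (down r x - {p})" "layer r (h - 1)"] tV by simp
  show False
  \<comment> \<open>For \<open>h = 2\<close> the layers have 1, 3 and 2 vertices, an even total. For
    larger \<open>h\<close> the triple fills layer \<open>h - 1\<close> injectively, yet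
    \<open>p\<close> and \<open>t\<close> have equal downward sets.\<close>
  proof (cases "h = 2")
    case True
    have V: "V = (layer r 0 \<union> layer r 1) \<union> layer r 2" using top True by (fastforce simp: layer_def)
    have "card V = card (layer r 0 \<union> layer r 1) + card (layer r 2)"
      by (subst V, rule card_Un_disjoint) (auto simp: layer_def finite_V)
    also have "card (layer r 0 \<union> layer r 1) = card (layer r 0) + card (layer r 1)"
      by (rule card_Un_disjoint) (auto simp: layer_def finite_V)
    finally have "card V = 6"
      using hl True lev by (simp add: layer_0[OF r] layer_1[OF r] deg del: One_nat_def)
    then show False using odd_card by simp
  next
    case False
    then have h3: "h \<ge> 3" using h2 by simp
    have "\<exists>a b c. triple r (h - 1) a b c \<and> (h - 1 \<ge> 2 \<longrightarrow> inj_on (down r) {a, b, c})"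
      by (rule triple_exists[OF r ex deg]) (use h3 lev xy(2) lp lt in \<open>auto simp: intra\<close>)
    then obtain a b c where abc: "triple r (h - 1) a b c" "inj_on (down r) {a, b, c}" using h3 by auto
    then have "{a, b, c} \<subseteq> layer r (h - 1)" "card {a, b, c} = 3" by (auto simp: triple_def)
    then have "{a, b, c} = layer r (h - 1)" using c3 by (intro card_seteq) auto
    moreover have "p \<in> layer r (h - 1)" "t \<in> layer r (h - 1)" using lp lt lev tV by (auto simp: layer_def)
    ultimately have neq: "down r p \<noteq> down r t" using abc(2) tV by (metis inj_onD)
    have sub: "down r b \<subseteq> down r a" if ab: "(a, b) \<in> {(p, t), (t, p)}" for a b
    proof
      fix d assume d: "d \<in> down r b"
      have lab: "Suc (level r a) = h" "Suc (level r b) = h" "a \<sim> b" "a \<in> V"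
        using ab lp lt lev tV t(2) adjacent_commute by auto
      have ld: "d \<sim> b" "Suc (Suc (level r d)) = h" "d \<in> V" using d lab adjacent_in_V by (auto simp: down_def)
      have "d \<sim> a"
      proof (rule ccontr)
        assume "\<not> d \<sim> a"
        moreover have "d \<noteq> a" using ld lab by auto
        ultimately obtain w where w: "w \<noteq> b" "w \<sim> d" "w \<sim> a"
          using another_common_neighbour[of d a b] ld lab adjacent_sym by blast
        have "(w, a) \<notin> intra r" "(w, d) \<notin> intra r"
          using w ab lab ld xy(2) lev lp lt unfolding intra by auto
        then have "level r w \<noteq> level r a" "level r w \<noteq> level r d"
          using not_intra_level w(2,3) by blast+
        then show False
          using adjacent_levels[OF r w(2)] adjacent_levels[OF r w(3)] ld(2) lab(1) by arith
      qed
      then show "d \<in> down r a" using ld lab by (simp add: down_def)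
    qed
    show False using neq sub[of p t] sub[of t p] by auto
  qed
qed

text \<open>The degrees sum to less than four times the number of vertices, so some root has degree
  3 if none has degree 2. Its slack of two allows one edge inside a layer, whose ends are twins, or
  two such edges and no excess.\<close>

lemma exists_degree_2: "\<exists>u\<in>V. card (neighbours u) = 2"
proof (rule ccontr)
  assume no: "\<not> (\<exists>u\<in>V. card (neighbours u) = 2)"
  then have deg3: "card (neighbours u) \<ge> 3" if "u \<in> V" for u
    using degree_ge_2[OF that] that by (metis Suc_leI eval_nat_numeral(3) le_neq_implies_less)
  have "\<exists>r\<in>V. card (neighbours r) < 4"
  proof (rule ccontr)
    assume "\<not> (\<exists>r\<in>V. card (neighbours r) < 4)"
    then have "(\<Sum>u\<in>V. 4) \<le> (\<Sum>u\<in>V. card (neighbours u))" by (intro sum_mono) auto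
    also have "\<dots> = card (Sigma V neighbours)" using finite_V by simp
    also have "Sigma V neighbours = {(u, v). u \<sim> v}"
      using adjacent_commute adjacent_in_V by (auto simp: neighbours_def)
    finally show False using card_arcs by simp
  qed
  then obtain r where r: "r \<in> V" "card (neighbours r) = 3" using deg3 by force
  have "2 * excess r + card (intra r) = 4" "card (intra r) \<ge> 2"
    using degree_formula[OF r(1)] intra_cards[OF r(1)] r(2) by auto
  then have "card (intra r) = 2 \<or> excess r = 0 \<and> card (intra r) = 4" by arith
  then show False
  proof (elim disjE conjE)
    assume "card (intra r) = 2"
    then obtain x y where intra: "intra r = {(x, y), (y, x)}" by (rule card_intra_2)
    have "z \<sim> x \<longleftrightarrow> z \<sim> y" if "z \<noteq> x" "z \<noteq> y" for z
      using twins_if_single_intra[OF r(1) intra, of z] twins_if_single_intra[OF r(1), of y x z] intra that by auto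
    moreover have "x \<sim> y" using intra by (auto simp: intra_def)
    ultimately show False using adjacent_twins_degree_2 no by blast
  next
    assume "excess r = 0" "card (intra r) = 4"
    then show False using no_two_intra_edges[OF r] deg3 by blast
  qed
qed

end

section \<open>Recognizing the candle\<close>

text \<open>Halving recovers the level; the bound excludes 0, which would otherwise join 1 in level
  0.\<close>

lemma candle_level_iff: "m \<in> candle_level i \<longleftrightarrow> 1 \<le> m \<and> m div 2 = i"
  by (auto simp: candle_level_def)

text \<open>Matches the layer sizes 1, 2, ..., 2 obtained from a root of degree two.\<close>

lemma card_candle_level: "card (candle_level i) = (if i = 0 then 1 else 2)"
  by (simp add: candle_level_def)

lemma candle_edge_iff:
  assumes a: "a \<in> candle_vertices h" and b: "b \<in> candle_vertices h"
  shows "{a, b} \<in> candle_edges h \<longleftrightarrow> Suc (a div 2) = b div 2 \<or> Suc (b div 2) = a div 2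
    \<or> (a div 2 = h \<and> b div 2 = h \<and> a \<noteq> b)" (is "?L \<longleftrightarrow> ?R")
proof
  assume ?L
  then consider u v i where "{a, b} = {u, v}" "u \<in> candle_level i" "v \<in> candle_level (i + 1)"
    | "{a, b} = {2 * h, 2 * h + 1}"
    unfolding candle_edges_def by blast
  then show ?R
    by cases (auto simp: candle_level_iff doubleton_eq_iff)
next
  assume ?R
  have ab: "1 \<le> a" "a \<le> 2 * h + 1" "1 \<le> b" "b \<le> 2 * h + 1"
    using a b by (auto simp: candle_vertices_def)
  from \<open>?R\<close> consider "Suc (a div 2) = b div 2" | "Suc (b div 2) = a div 2"
    | "a div 2 = h \<and> b div 2 = h \<and> a \<noteq> b" by blast
  then show ?L
  proof cases
    case 1
    then have "a div 2 < h" "a \<in> candle_level (a div 2)" "b \<in> candle_level (a div 2 + 1)"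
      using ab by (auto simp: candle_level_iff)
    then show ?thesis unfolding candle_edges_def by blast
  next
    case 2
    then have "b div 2 < h" "b \<in> candle_level (b div 2)" "a \<in> candle_level (b div 2 + 1)"
      using ab by (auto simp: candle_level_iff)
    moreover have "{a, b} = {b, a}" by auto
    ultimately show ?thesis unfolding candle_edges_def by blast
  next
    case 3
    then have "a = 2 * h \<and> b = 2 * h + 1 \<or> a = 2 * h + 1 \<and> b = 2 * h" by presburger
    then have "{a, b} = {2 * h, 2 * h + 1}" by auto
    then show ?thesis unfolding candle_edges_def by simp
  qed
qed

text \<open>Adjacency depends only on levels and distinctness, so arbitrary bijections
  \<open>g\<close> between corresponding levels glue to an isomorphism.\<close>

lemma candle_iso_by_levels:
  fixes lev :: "'a \<Rightarrow> nat"
  assumes fin: "finite V" and h: "\<And>u. u \<in> V \<Longrightarrow> lev u \<le> h"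
    and card_lev: "\<And>i. i \<le> h \<Longrightarrow> card {u \<in> V. lev u = i} = card (candle_level i)"
    and edge: "\<And>u v. u \<in> V \<Longrightarrow> v \<in> V \<Longrightarrow> {u, v} \<in> E \<longleftrightarrow>
      Suc (lev u) = lev v \<or> Suc (lev v) = lev u \<or> (lev u = h \<and> lev v = h \<and> u \<noteq> v)"
  shows "graph_iso V E (candle_vertices h) (candle_edges h)"
proof -
  have "\<exists>g. bij_betw g {u \<in> V. lev u = i} (candle_level i)" if "i \<le> h" for i
    by (rule finite_same_card_bij) (use fin card_lev[OF that] in \<open>auto simp: candle_level_def\<close>)
  then obtain g where g: "\<And>i. i \<le> h \<Longrightarrow> bij_betw (g i) {u \<in> V. lev u = i} (candle_level i)" by metis
  define f where "f u = g (lev u) u" for u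
  have f_lev: "f u div 2 = lev u" "1 \<le> f u" if "u \<in> V" for u
  proof -
    have "f u \<in> candle_level (lev u)"
      unfolding f_def using bij_betwE[OF g[OF h[OF that]]] that by blast
    then show "f u div 2 = lev u" "1 \<le> f u" by (auto simp: candle_level_iff)
  qed
  have inj: "inj_on f V"
  proof (rule inj_onI)
    fix u v assume uv: "u \<in> V" "v \<in> V" "f u = f v"
    then have l: "lev u = lev v" using f_lev by metis
    then show "u = v"
      using bij_betw_imp_inj_on[OF g[OF h[OF uv(1)]]] uv unfolding f_def inj_on_def by auto
  qed
  have img: "f ` V = candle_vertices h"
  proof
    have "f u \<le> 2 * h + 1" if "u \<in> V" for u using f_lev(1)[OF that] h[OF that] by linarith
    then show "f ` V \<subseteq> candle_vertices h" using f_lev(2) by (auto simp: candle_vertices_def)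
    show "candle_vertices h \<subseteq> f ` V"
    proof
      fix m assume "m \<in> candle_vertices h"
      then have m: "m \<in> candle_level (m div 2)" "m div 2 \<le> h"
        by (auto simp: candle_level_iff candle_vertices_def)
      then have "m \<in> g (m div 2) ` {u \<in> V. lev u = m div 2}"
        using bij_betw_imp_surj_on[OF g[OF m(2)]] by simp
      then obtain u where "u \<in> V" "lev u = m div 2" "g (m div 2) u = m" by auto
      then show "m \<in> f ` V" by (intro image_eqI[of _ _ u]) (auto simp: f_def)
    qed
  qed
  have "{u, v} \<in> E \<longleftrightarrow> {f u, f v} \<in> candle_edges h" if uv: "u \<in> V" "v \<in> V" for u v
  proof -
    have "f u \<in> candle_vertices h" "f v \<in> candle_vertices h" using img uv by auto
    moreover have "f u = f v \<longleftrightarrow> u = v" using inj uv by (auto dest: inj_onD)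
    ultimately show ?thesis using edge[OF uv] f_lev(1) uv by (simp add: candle_edge_iff)
  qed
  then show ?thesis unfolding graph_iso_def bij_betw_def using inj img by blast
qed

section \<open>From edge sets and \<open>q\<close> to the abstract setting\<close>

lemma card_arcs_eq:
  fixes E :: "nat set set"
  assumes g: "simple_graph V E"
  shows "card {(u, v). adj E u v} = 2 * card E"
proof -
  have edge: "\<exists>u v. e = {u, v} \<and> u \<noteq> v \<and> u \<in> V \<and> v \<in> V" if "e \<in> E" for e
    using g that by (auto simp: simple_graph_def)
  have neq: "u \<noteq> v \<and> u \<in> V \<and> v \<in> V" if "adj E u v" for u v
    using edge[of "{u, v}"] that by (auto simp: adj_def doubleton_eq_iff)
  define A where "A = {(u, v). adj E u v \<and> u < v}"
  have "A \<subseteq> V \<times> V" using neq by (auto simp: A_def)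
  then have finA: "finite A" using g finite_subset by (auto simp: simple_graph_def)
  have "(\<lambda>(u, v). {u, v}) ` A = E"
  proof
    show "E \<subseteq> (\<lambda>(u, v). {u, v}) ` A"
    proof
      fix e assume e: "e \<in> E"
      then obtain u v where uv: "e = {u, v}" "u \<noteq> v" using edge by blast
      have "(min u v, max u v) \<in> A" "e = {min u v, max u v}"
        using uv e by (auto simp: A_def adj_def min_def max_def insert_commute)
      then show "e \<in> (\<lambda>(u, v). {u, v}) ` A" by force
    qed
  qed (auto simp: A_def adj_def)
  moreover have "inj_on (\<lambda>(u, v). {u, v}) A" by (auto simp: inj_on_def A_def doubleton_eq_iff)
  ultimately have cE: "card A = card E" by (metis card_image)
  have arcs: "{(u, v). adj E u v} = A \<union> prod.swap ` A"
  proof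
    show "{(u, v). adj E u v} \<subseteq> A \<union> prod.swap ` A"
    proof
      fix a assume "a \<in> {(u, v). adj E u v}"
      then obtain u v where a: "a = (u, v)" "adj E u v" by auto
      then have "(u, v) \<in> A \<or> (v, u) \<in> A"
        using neq[OF a(2)] by (auto simp: A_def adj_def insert_commute)
      then show "a \<in> A \<union> prod.swap ` A" unfolding a(1) by (metis UnI1 UnI2 image_eqI swap_simp)
    qed
  qed (auto simp: A_def adj_def insert_commute)
  have "card (A \<union> prod.swap ` A) = card A + card (prod.swap ` A)"
    by (rule card_Un_disjoint) (use finA in simp_all, auto simp: A_def)
  also have "card (prod.swap ` A) = card A" by (rule card_image) simp
  finally show ?thesis using arcs cE by simp
qed

text \<open>The least value is attained because \<open>S_set\<close> is inhabited, for instance by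
  the 0-1 matrix of \<open>E\<close>.\<close>

lemma q_attained:
  obtains A where "A \<in> S_set n E" "num_distinct_eigenvalues A = q n E"
proof -
  have "mat n n (\<lambda>(i, j). if {i, j} \<in> E then 1 else 0) \<in> S_set n E"
    by (auto simp: S_set_def insert_commute intro!: eq_matI)
  then have "\<exists>k. \<exists>A \<in> S_set n E. num_distinct_eigenvalues A = k" by blast
  from LeastI_ex[OF this] show ?thesis using that unfolding q_def by blast
qed

theorem mainTheorem11:
  fixes n :: nat and E :: "nat set set"
  assumes "simple_graph {0..<n} E"
    and "connected_graph {0..<n} E"
    and "odd n" and "n \<ge> 3"
    and "q n E = 2"
    and "card E = 2 * n - 3"
  shows "graph_iso {0..<n} E (candle_vertices ((n - 1) div 2)) (candle_edges ((n - 1) div 2))"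
proof -
  let ?V = "{0..<n}"
  have adj_V: "u \<noteq> v \<and> u \<in> ?V \<and> v \<in> ?V" if "adj E u v" for u v
  proof -
    have "{u, v} \<in> E" using that by (simp add: adj_def)
    then obtain u' v' where "{u, v} = {u', v'}" "u' \<noteq> v'" "u' \<in> ?V" "v' \<in> ?V"
      using assms(1) unfolding simple_graph_def by blast
    then show ?thesis by (metis doubleton_eq_iff)
  qed
  obtain A where A: "A \<in> S_set n E" "num_distinct_eigenvalues A = 2"
    using q_attained[of n E] assms(5) by metis
  then have A': "A \<in> carrier_mat n n" "A\<^sup>T = A"
    "\<And>i j. i < n \<Longrightarrow> j < n \<Longrightarrow> i \<noteq> j \<Longrightarrow> A $$ (i, j) \<noteq> 0 \<longleftrightarrow> {i, j} \<in> E"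
    by (auto simp: S_set_def)
  obtain M :: "nat \<Rightarrow> nat \<Rightarrow> real" and s where M: "\<forall>i<n. \<forall>j<n. M i j = M j i
    \<and> (i \<noteq> j \<longrightarrow> M i j = A $$ (i,j)) \<and> (\<Sum>k<n. M i k * M k j) = (if i = j then s else 0)"
    using symmetric_two_eigenvalues_shift[OF A'(1,2) A(2)] by blast
  interpret sparse_two_eigenvalue_graph ?V "adj E" M s
  proof
    show "adj E u v \<Longrightarrow> u \<in> ?V \<and> v \<in> ?V" "\<not> adj E u u" for u v using adj_V by blast+
    show "adj E u v \<Longrightarrow> adj E v u" for u v by (simp add: adj_def insert_commute)
    show "(adj E)\<^sup>*\<^sup>* u v" if "u \<in> ?V" "v \<in> ?V" for u v
      using assms(2) that by (simp add: connected_graph_def)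
    show "M u v \<noteq> 0 \<longleftrightarrow> adj E u v" if "u \<in> ?V" "v \<in> ?V" "u \<noteq> v" for u v
      using that M A'(3) by (simp add: adj_def)
    show "(\<Sum>w\<in>?V. M u w * M w v) = (if u = v then s else 0)" if "u \<in> ?V" "v \<in> ?V" for u v
      using that M unfolding atLeast0LessThan by blast
    \<comment> \<open>The bound \<open>n \<ge> 3\<close> makes the subtraction in
      \<open>2 * n - 3\<close> exact.\<close>
    show "card {(u, v). adj E u v} + 6 = 4 * card ?V"
      using card_arcs_eq[OF assms(1)] assms(4,6) by simp
  qed (use assms(3) M in auto)
  obtain r where r: "r \<in> ?V" "card (neighbours r) = 2" using exists_degree_2 by blast
  obtain h where h: "h \<ge> 1" "card ?V = 2 * h + 1" "\<forall>u\<in>?V. level r u \<le> h"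
    "\<forall>i. 1 \<le> i \<and> i \<le> h \<longrightarrow> card (layer r i) = 2"
    "\<forall>u\<in>?V. \<forall>v\<in>?V. adj E u v \<longleftrightarrow> Suc (level r u) = level r v \<or> Suc (level r v) = level r u
          \<or> (level r u = h \<and> level r v = h \<and> u \<noteq> v)"
    using candle_layers[OF r] by blast
  have "graph_iso ?V E (candle_vertices h) (candle_edges h)"
  proof (rule candle_iso_by_levels[of _ "level r"])
    show "card {u \<in> ?V. level r u = i} = card (candle_level i)" if "i \<le> h" for i
      using h(4) that layer_0[OF r(1)] by (cases "i = 0") (auto simp: card_candle_level layer_def)
    show "{u, v} \<in> E \<longleftrightarrow> Suc (level r u) = level r v \<or> Suc (level r v) = level r u
        \<or> (level r u = h \<and> level r v = h \<and> u \<noteq> v)" if "u \<in> ?V" "v \<in> ?V" for u v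
      using h(5) that by (simp add: adj_def)
  qed (use h(3) in auto)
  moreover have "(n - 1) div 2 = h" using h(2) by simp
  ultimately show ?thesis by simp
qed

end
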